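(* Let $f:\Omega\times\mathbb{R}\to\mathbb{R}$ satisfy $(A_1)$–$(A_4)$, let $p\ge2$ with $p>\frac d2$, let $\mathcal C_{ad}\subset L^p(\Omega)$ be nonempty, bounded, closed and convex, $g\in L^2(\Omega)$, $\alpha>0$. Suppose that $\overline u\in\mathcal C_{ad}$ is strongly stationary. Then $\overline u$ is $B$-stationary.
   Context: $\Omega\subset\mathbb{R}^d$, $d\ge2$, is an open, bounded Lipschitz domain. $Y:=\{y\in H^1_0(\Omega):\Delta y\in L^2(\Omega)\}$ is a Hilbert space with inner product $(y,v)_Y=\int_\Omega \Delta y\,\Delta v+\nabla y\cdot\nabla v+yv\,dx$. $\langle\cdot,\cdot\rangle$ is the $L^2(\Omega)$ inner product. Assumptions on $f$: $(A_1)$ for every $y\in\mathbb{R}$, $x\mapsto f(x,y)$ is Lebesgue measurable, and $f(\cdot,0)\in L^\infty(\Omega)$; $(A_2)$ for every $M>0$ there is $L=L(M)>0$ such that for all $y_1,y_2\in(-M,M)$: $|f(x,y_1)-f(x,y_2)|\le L|y_1-y_2|$ for almost every $x\in\Omega$; $(A_3)$ for almost every $x\in\Omega$, $y\mapsto f(x,y)$ is monotone increasing (not necessarily strictly); $(A_4)$ for almost every $x\in\Omega$, $y\mapsto f(x,y)$ is directionally differentiable, with directional derivative $f_x'(y;h)$. Write $f'_{\pm}(\overline y(x)):=\pm f_x'(\overline y(x);\pm1)$ (right/left derivative of $f(x,\cdot)$ at $\overline y(x)$). For $u\in L^p(\Omega)$, $S(u)=y$ is the unique (weak) solution $y\in Y\cap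 C^{0,a}(\overline\Omega)$ of $-\Delta y+f(\cdot,y)=u$ in $\Omega$, $y=0$ on $\partial\Omega$ ($a>0$ a Hölder exponent depending only on $p,d,\Omega$). $S'(u;h)$ is the (Hadamard) directional derivative of $S:L^p(\Omega)\to Y$ at $u$ in direction $h$, i.e. the limit in $Y$ of $(S(u+th)-S(u))/t$ as $t\to0^+$. Contingent cone: $T_{\mathcal C_{ad}}(\overline u):=\{h\in L^p(\Omega):\exists\,t_n\downarrow0,\ h_n\to h\text{ in }L^p(\Omega)\text{ with }\overline u+t_nh_n\in\mathcal C_{ad}\ \forall n\}$. For $\overline u\in\mathcal C_{ad}$ with state $\overline y=S(\overline u)$: - $B$-stationary: $\langle\overline y-g,S'(\overline u;h)\rangle+\alpha\langle\overline u,h\rangle\ge0$ for all $h\in T_{\mathcal C_{ad}}(\overline u)$. - $C$-stationary: there exist a nonnegative $\zeta\in L^\infty(\Omega)$ and an adjoint state $\varphi\in Y$ with $-\Delta\varphi+\zeta\varphi=\overline y-g$ in $\Omega$, $\langle\varphi+\alpha\overline u,u-\overline u\rangle\ge0$ for all $u\in\mathcal C_{ad}$, and $\zeta(x)\in\partial f(x,\overline y(x))$ for a.e. $x\in\Omega$, where $\partial f(x,y)$ is Clarke's generalized gradient of $f(x,\cdot)$ at $y$. - Strongly stationary: $C$-stationary, with $\zeta,\varphi$ additionally satisfying $\zeta(x)\varphi(x)\in[f'_+(\overline y(x))\varphi(x),\,f'_-(\overline y(x))\varphi(x)]$ (i.e. $f'_+\varphi\le\zeta\varphi\le f'_-\varphi$)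 for a.e. $x\in\Omega$. *)

theory Defs
  imports "HOL-Analysis.Analysis"
begin

section \<open>Lipschitz domains\<close>

text \<open>
  Near each boundary point, in suitable orthogonal coordinates with vertical unit vector \<open>e\<close>,
  the set is the region strictly above the graph of a Lipschitz function of the horizontal
  component \<open>x - (x \<bullet> e) e\<close>.
\<close>

definition lipschitz_boundary :: "'a::euclidean_space set \<Rightarrow> bool" where
  "lipschitz_boundary \<Omega> \<longleftrightarrow>
     (\<forall>x0\<in>frontier \<Omega>. \<exists>r>0. \<exists>e L \<gamma>. norm e = 1 \<and> L-lipschitz_on {z. z \<bullet> e = 0} \<gamma> \<and>
        \<Omega> \<inter> ball x0 r = {x \<in> ball x0 r. \<gamma> (x - (x \<bullet> e) *\<^sub>R e) < x \<bullet> e})"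

definition lipschitz_domain :: "'a::euclidean_space set \<Rightarrow> bool" where
  "lipschitz_domain \<Omega> \<longleftrightarrow> open \<Omega> \<and> bounded \<Omega> \<and> lipschitz_boundary \<Omega>"


section \<open>Lebesgue spaces\<close>

text \<open>
  Elements of Lebesgue and Sobolev spaces are represented by functions on the whole space; only
  their values on \<open>\<Omega>\<close>, up to null sets, matter.
\<close>

definition Lp :: "'a::euclidean_space set \<Rightarrow> real \<Rightarrow> ('a \<Rightarrow> 'b::euclidean_space) set" where
  "Lp \<Omega> p = {u. u \<in> borel_measurable (lebesgue_on \<Omega>) \<and>
                 integrable (lebesgue_on \<Omega>) (\<lambda>x. norm (u x) powr p)}"

definition Lp_norm :: "'a::euclidean_space set \<Rightarrow> real \<Rightarrow> ('a \<Rightarrow> 'b::euclidean_space) \<Rightarrow> real" where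
  "Lp_norm \<Omega> p u = (\<integral>x. norm (u x) powr p \<partial>lebesgue_on \<Omega>) powr (1 / p)"

definition Linf :: "'a::euclidean_space set \<Rightarrow> ('a \<Rightarrow> real) set" where
  "Linf \<Omega> = {u. u \<in> borel_measurable (lebesgue_on \<Omega>) \<and>
                (\<exists>K. AE x in lebesgue_on \<Omega>. \<bar>u x\<bar> \<le> K)}"

definition L2_inner :: "'a::euclidean_space set \<Rightarrow> ('a \<Rightarrow> real) \<Rightarrow> ('a \<Rightarrow> real) \<Rightarrow> real" where
  "L2_inner \<Omega> u v = (\<integral>x. u x * v x \<partial>lebesgue_on \<Omega>)"

definition Lp_bounded :: "'a::euclidean_space set \<Rightarrow> real \<Rightarrow> ('a \<Rightarrow> real) set \<Rightarrow> bool" where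
  "Lp_bounded \<Omega> p C \<longleftrightarrow> (\<exists>R. \<forall>u\<in>C. Lp_norm \<Omega> p u \<le> R)"

text \<open>
  Sequential closedness also makes a set of representatives saturated with respect to equality
  almost everywhere on \<open>\<Omega>\<close> (take a constant sequence).
\<close>

definition Lp_closed :: "'a::euclidean_space set \<Rightarrow> real \<Rightarrow> ('a \<Rightarrow> real) set \<Rightarrow> bool" where
  "Lp_closed \<Omega> p C \<longleftrightarrow>
     (\<forall>un u. (\<forall>n::nat. un n \<in> C) \<and> u \<in> Lp \<Omega> p \<and>
             (\<lambda>n. Lp_norm \<Omega> p (\<lambda>x. un n x - u x)) \<longlonglongrightarrow> 0 \<longrightarrow> u \<in> C)"

definition fun_convex :: "('a \<Rightarrow> real) set \<Rightarrow> bool" where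
  "fun_convex C \<longleftrightarrow>
     (\<forall>u\<in>C. \<forall>v\<in>C. \<forall>s\<in>{0..1}. (\<lambda>x. (1 - s) * u x + s * v x) \<in> C)"


section \<open>Test functions, weak derivatives, Sobolev spaces\<close>

definition partial_deriv :: "'a::euclidean_space \<Rightarrow> ('a \<Rightarrow> real) \<Rightarrow> 'a \<Rightarrow> real" where
  "partial_deriv b \<phi> x = frechet_derivative \<phi> (at x) b"

primrec Ck :: "nat \<Rightarrow> ('a::euclidean_space \<Rightarrow> real) \<Rightarrow> bool" where
  "Ck 0 \<phi> \<longleftrightarrow> continuous_on UNIV \<phi>"
| "Ck (Suc k) \<phi> \<longleftrightarrow> (\<forall>x. \<phi> differentiable (at x)) \<and> (\<forall>b\<in>Basis. Ck k (partial_deriv b \<phi>))"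

definition test_function :: "'a::euclidean_space set \<Rightarrow> ('a \<Rightarrow> real) \<Rightarrow> bool" where
  "test_function \<Omega> \<phi> \<longleftrightarrow>
     (\<forall>k. Ck k \<phi>) \<and> compact (closure {x. \<phi> x \<noteq> 0}) \<and> closure {x. \<phi> x \<noteq> 0} \<subseteq> \<Omega>"

definition is_weak_grad :: "'a::euclidean_space set \<Rightarrow> ('a \<Rightarrow> real) \<Rightarrow> ('a \<Rightarrow> 'a) \<Rightarrow> bool" where
  "is_weak_grad \<Omega> y G \<longleftrightarrow> G \<in> Lp \<Omega> 2 \<and>
     (\<forall>\<phi>. test_function \<Omega> \<phi> \<longrightarrow>
        (\<forall>b\<in>Basis. (\<integral>x. y x * partial_deriv b \<phi> x \<partial>lebesgue_on \<Omega>)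
                    = - (\<integral>x. (G x \<bullet> b) * \<phi> x \<partial>lebesgue_on \<Omega>)))"

text \<open>The choice below is unique up to null sets whenever a weak gradient exists.\<close>

definition weak_grad :: "'a::euclidean_space set \<Rightarrow> ('a \<Rightarrow> real) \<Rightarrow> 'a \<Rightarrow> 'a" where
  "weak_grad \<Omega> y = (SOME G. is_weak_grad \<Omega> y G)"

definition H1 :: "'a::euclidean_space set \<Rightarrow> ('a \<Rightarrow> real) set" where
  "H1 \<Omega> = {y \<in> Lp \<Omega> 2. \<exists>G. is_weak_grad \<Omega> y G}"

definition H1_norm :: "'a::euclidean_space set \<Rightarrow> ('a \<Rightarrow> real) \<Rightarrow> real" where
  "H1_norm \<Omega> y = sqrt ((Lp_norm \<Omega> 2 y)\<^sup>2 + (Lp_norm \<Omega> 2 (weak_grad \<Omega> y))\<^sup>2)"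

text \<open>The closure of the test functions in the Sobolev norm.\<close>

definition H10 :: "'a::euclidean_space set \<Rightarrow> ('a \<Rightarrow> real) set" where
  "H10 \<Omega> = {y \<in> H1 \<Omega>. \<exists>\<phi>n. (\<forall>n::nat. test_function \<Omega> (\<phi>n n)) \<and>
                         (\<lambda>n. H1_norm \<Omega> (\<lambda>x. \<phi>n n x - y x)) \<longlonglongrightarrow> 0}"

text \<open>\<open>w\<close> is the distributional Laplacian of \<open>y\<close>, and it is square integrable.\<close>

definition is_weak_laplacian :: "'a::euclidean_space set \<Rightarrow> ('a \<Rightarrow> real) \<Rightarrow> ('a \<Rightarrow> real) \<Rightarrow> bool" where
  "is_weak_laplacian \<Omega> y w \<longleftrightarrow> w \<in> Lp \<Omega> 2 \<and>
     (\<forall>\<phi>. test_function \<Omega> \<phi> \<longrightarrow>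
        (\<integral>x. y x * (\<Sum>b\<in>Basis. partial_deriv b (partial_deriv b \<phi>) x) \<partial>lebesgue_on \<Omega>)
        = (\<integral>x. w x * \<phi> x \<partial>lebesgue_on \<Omega>))"

definition weak_laplacian :: "'a::euclidean_space set \<Rightarrow> ('a \<Rightarrow> real) \<Rightarrow> 'a \<Rightarrow> real" where
  "weak_laplacian \<Omega> y = (SOME w. is_weak_laplacian \<Omega> y w)"

definition Y_space :: "'a::euclidean_space set \<Rightarrow> ('a \<Rightarrow> real) set" where
  "Y_space \<Omega> = {y \<in> H10 \<Omega>. \<exists>w. is_weak_laplacian \<Omega> y w}"

definition Y_inner :: "'a::euclidean_space set \<Rightarrow> ('a \<Rightarrow> real) \<Rightarrow> ('a \<Rightarrow> real) \<Rightarrow> real" where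
  "Y_inner \<Omega> y v =
     (\<integral>x. weak_laplacian \<Omega> y x * weak_laplacian \<Omega> v x
          + weak_grad \<Omega> y x \<bullet> weak_grad \<Omega> v x + y x * v x \<partial>lebesgue_on \<Omega>)"

definition Y_norm :: "'a::euclidean_space set \<Rightarrow> ('a \<Rightarrow> real) \<Rightarrow> real" where
  "Y_norm \<Omega> y = sqrt (Y_inner \<Omega> y y)"

definition holder_space :: "'a::euclidean_space set \<Rightarrow> real \<Rightarrow> ('a \<Rightarrow> real) set" where
  "holder_space K a = {y. continuous_on K y \<and>
                          (\<exists>B. \<forall>x\<in>K. \<forall>z\<in>K. \<bar>y x - y z\<bar> \<le> B * dist x z powr a)}"


section \<open>The nonlinearity\<close>

definition has_dir_deriv :: "(real \<Rightarrow> real) \<Rightarrow> real \<Rightarrow> real \<Rightarrow> real \<Rightarrow> bool" where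
  "has_dir_deriv F y h D \<longleftrightarrow> ((\<lambda>t. (F (y + t * h) - F y) / t) \<longlongrightarrow> D) (at_right 0)"

definition dir_deriv :: "(real \<Rightarrow> real) \<Rightarrow> real \<Rightarrow> real \<Rightarrow> real" where
  "dir_deriv F y h = Lim (at_right 0) (\<lambda>t. (F (y + t * h) - F y) / t)"

definition right_deriv :: "(real \<Rightarrow> real) \<Rightarrow> real \<Rightarrow> real" where
  "right_deriv F y = dir_deriv F y 1"

definition left_deriv :: "(real \<Rightarrow> real) \<Rightarrow> real \<Rightarrow> real" where
  "left_deriv F y = - dir_deriv F y (- 1)"

definition clarke_dir_deriv :: "(real \<Rightarrow> real) \<Rightarrow> real \<Rightarrow> real \<Rightarrow> ereal" where
  "clarke_dir_deriv F y v =
     Limsup (nhds y \<times>\<^sub>F at_right 0) (\<lambda>(z, t). ereal ((F (z + t * v) - F z) / t))"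

definition clarke_gradient :: "(real \<Rightarrow> real) \<Rightarrow> real \<Rightarrow> real set" where
  "clarke_gradient F y = {\<xi>. \<forall>v. ereal (\<xi> * v) \<le> clarke_dir_deriv F y v}"

definition A1 :: "'a::euclidean_space set \<Rightarrow> ('a \<Rightarrow> real \<Rightarrow> real) \<Rightarrow> bool" where
  "A1 \<Omega> f \<longleftrightarrow> (\<forall>y. (\<lambda>x. f x y) \<in> borel_measurable (lebesgue_on \<Omega>)) \<and> (\<lambda>x. f x 0) \<in> Linf \<Omega>"

text \<open>The exceptional null set may depend on the two points.\<close>

definition A2 :: "'a::euclidean_space set \<Rightarrow> ('a \<Rightarrow> real \<Rightarrow> real) \<Rightarrow> bool" where
  "A2 \<Omega> f \<longleftrightarrow> (\<forall>M>0. \<exists>L>0. \<forall>y1\<in>{-M<..<M}. \<forall>y2\<in>{-M<..<M}.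
                 AE x in lebesgue_on \<Omega>. \<bar>f x y1 - f x y2\<bar> \<le> L * \<bar>y1 - y2\<bar>)"

definition A3 :: "'a::euclidean_space set \<Rightarrow> ('a \<Rightarrow> real \<Rightarrow> real) \<Rightarrow> bool" where
  "A3 \<Omega> f \<longleftrightarrow> (AE x in lebesgue_on \<Omega>. mono (f x))"

definition A4 :: "'a::euclidean_space set \<Rightarrow> ('a \<Rightarrow> real \<Rightarrow> real) \<Rightarrow> bool" where
  "A4 \<Omega> f \<longleftrightarrow> (AE x in lebesgue_on \<Omega>. \<forall>y h. \<exists>D. has_dir_deriv (f x) y h D)"


section \<open>State equation and control-to-state map\<close>

text \<open>Weak formulation of \<open>- \<Delta>y + q = F\<close> in \<open>\<Omega>\<close>.\<close>

definition weak_solution ::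
  "'a::euclidean_space set \<Rightarrow> ('a \<Rightarrow> real) \<Rightarrow> ('a \<Rightarrow> real) \<Rightarrow> ('a \<Rightarrow> real) \<Rightarrow> bool" where
  "weak_solution \<Omega> y q F \<longleftrightarrow>
     (\<forall>v\<in>H10 \<Omega>. (\<integral>x. weak_grad \<Omega> y x \<bullet> weak_grad \<Omega> v x \<partial>lebesgue_on \<Omega>) + L2_inner \<Omega> q v
                 = L2_inner \<Omega> F v)"

definition is_state ::
  "'a::euclidean_space set \<Rightarrow> ('a \<Rightarrow> real \<Rightarrow> real) \<Rightarrow> real \<Rightarrow> ('a \<Rightarrow> real) \<Rightarrow> ('a \<Rightarrow> real) \<Rightarrow> bool" where
  "is_state \<Omega> f a u y \<longleftrightarrow>
     y \<in> Y_space \<Omega> \<and> y \<in> holder_space (closure \<Omega>) a \<and>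
     weak_solution \<Omega> y (\<lambda>x. f x (y x)) u \<and> (\<forall>x\<in>frontier \<Omega>. y x = 0)"

text \<open>
  The two specifications below characterise \<open>S\<close> and \<open>S'\<close> up to the choice of representatives:
  states are unique because \<open>f x\<close> is monotone, and limits in \<open>Y\<close> are unique.
\<close>

definition control_to_state_map ::
  "'a::euclidean_space set \<Rightarrow> ('a \<Rightarrow> real \<Rightarrow> real) \<Rightarrow> real \<Rightarrow> real
    \<Rightarrow> (('a \<Rightarrow> real) \<Rightarrow> ('a \<Rightarrow> real)) \<Rightarrow> bool" where
  "control_to_state_map \<Omega> f p a S \<longleftrightarrow> (\<forall>u\<in>Lp \<Omega> p. is_state \<Omega> f a u (S u))"

definition directional_derivative_map ::
  "'a::euclidean_space set \<Rightarrow> real \<Rightarrow> (('a \<Rightarrow> real) \<Rightarrow> ('a \<Rightarrow> real))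
    \<Rightarrow> (('a \<Rightarrow> real) \<Rightarrow> ('a \<Rightarrow> real) \<Rightarrow> ('a \<Rightarrow> real)) \<Rightarrow> bool" where
  "directional_derivative_map \<Omega> p S S' \<longleftrightarrow>
     (\<forall>u\<in>Lp \<Omega> p. \<forall>h\<in>Lp \<Omega> p. S' u h \<in> Y_space \<Omega> \<and>
        ((\<lambda>t. Y_norm \<Omega> (\<lambda>x. (S (\<lambda>z. u z + t * h z) x - S u x) / t - S' u h x)) \<longlongrightarrow> 0)
          (at_right 0))"


section \<open>Stationarity concepts\<close>

definition contingent_cone ::
  "'a::euclidean_space set \<Rightarrow> real \<Rightarrow> ('a \<Rightarrow> real) set \<Rightarrow> ('a \<Rightarrow> real) \<Rightarrow> ('a \<Rightarrow> real) set" where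
  "contingent_cone \<Omega> p C ubar =
     {h \<in> Lp \<Omega> p. \<exists>(t::nat \<Rightarrow> real) hn. (\<forall>n. 0 < t n) \<and> t \<longlonglongrightarrow> 0 \<and>
        (\<forall>n. hn n \<in> Lp \<Omega> p) \<and> (\<lambda>n. Lp_norm \<Omega> p (\<lambda>x. hn n x - h x)) \<longlonglongrightarrow> 0 \<and>
        (\<forall>n. (\<lambda>x. ubar x + t n * hn n x) \<in> C)}"

definition B_stationary ::
  "'a::euclidean_space set \<Rightarrow> real \<Rightarrow> (('a \<Rightarrow> real) \<Rightarrow> ('a \<Rightarrow> real))
    \<Rightarrow> (('a \<Rightarrow> real) \<Rightarrow> ('a \<Rightarrow> real) \<Rightarrow> ('a \<Rightarrow> real))
    \<Rightarrow> ('a \<Rightarrow> real) set \<Rightarrow> ('a \<Rightarrow> real) \<Rightarrow> real \<Rightarrow> ('a \<Rightarrow> real) \<Rightarrow> bool" where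
  "B_stationary \<Omega> p S S' C g \<alpha> ubar \<longleftrightarrow>
     (\<forall>h\<in>contingent_cone \<Omega> p C ubar.
        L2_inner \<Omega> (\<lambda>x. S ubar x - g x) (S' ubar h) + \<alpha> * L2_inner \<Omega> ubar h \<ge> 0)"

definition C_stationary_with ::
  "'a::euclidean_space set \<Rightarrow> ('a \<Rightarrow> real \<Rightarrow> real) \<Rightarrow> (('a \<Rightarrow> real) \<Rightarrow> ('a \<Rightarrow> real))
    \<Rightarrow> ('a \<Rightarrow> real) set \<Rightarrow> ('a \<Rightarrow> real) \<Rightarrow> real \<Rightarrow> ('a \<Rightarrow> real)
    \<Rightarrow> ('a \<Rightarrow> real) \<Rightarrow> ('a \<Rightarrow> real) \<Rightarrow> bool" where
  "C_stationary_with \<Omega> f S C g \<alpha> ubar \<zeta> \<phi> \<longleftrightarrow>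
     \<zeta> \<in> Linf \<Omega> \<and> (AE x in lebesgue_on \<Omega>. 0 \<le> \<zeta> x) \<and> \<phi> \<in> Y_space \<Omega> \<and>
     weak_solution \<Omega> \<phi> (\<lambda>x. \<zeta> x * \<phi> x) (\<lambda>x. S ubar x - g x) \<and>
     (\<forall>u\<in>C. L2_inner \<Omega> (\<lambda>x. \<phi> x + \<alpha> * ubar x) (\<lambda>x. u x - ubar x) \<ge> 0) \<and>
     (AE x in lebesgue_on \<Omega>. \<zeta> x \<in> clarke_gradient (f x) (S ubar x))"

definition strongly_stationary ::
  "'a::euclidean_space set \<Rightarrow> ('a \<Rightarrow> real \<Rightarrow> real) \<Rightarrow> (('a \<Rightarrow> real) \<Rightarrow> ('a \<Rightarrow> real))
    \<Rightarrow> ('a \<Rightarrow> real) set \<Rightarrow> ('a \<Rightarrow> real) \<Rightarrow> real \<Rightarrow> ('a \<Rightarrow> real) \<Rightarrow> bool" where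
  "strongly_stationary \<Omega> f S C g \<alpha> ubar \<longleftrightarrow>
     (\<exists>\<zeta> \<phi>. C_stationary_with \<Omega> f S C g \<alpha> ubar \<zeta> \<phi> \<and>
        (AE x in lebesgue_on \<Omega>. right_deriv (f x) (S ubar x) * \<phi> x \<le> \<zeta> x * \<phi> x \<and>
                                \<zeta> x * \<phi> x \<le> left_deriv (f x) (S ubar x) * \<phi> x))"

end

theory Submission
  imports Defs
begin

text \<open>
  Let \<open>\<eta> = S'(u; h)\<close>. By the state equation, the Laplacian of the difference quotient
  \<open>(S(u + t h) - S(u)) / t\<close> is \<open>q - h\<close>, where \<open>q\<close> is the difference quotient of the
  nonlinearity. Convergence in \<open>Y\<close> therefore forces \<open>q\<close> to converge in \<open>L\<^sup>2\<close> to
  \<open>\<Delta>\<eta> + h\<close>; along an almost everywhere convergent subsequence the limit is also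
  \<open>f'(x, y; \<eta>)\<close>, because \<open>f\<close> is locally Lipschitz in its second argument. So
  \<open>- \<Delta>\<eta> + f'(\<cdot>, y; \<eta>) = h\<close>, and no uniform bound on the states is needed.
  Testing this with \<open>\<phi>\<close> and the adjoint equation with \<open>\<eta>\<close>, the sign condition
  \<open>f'(x, y; \<eta>) \<phi> \<le> \<zeta> \<phi> \<eta>\<close> gives
  \<open>\<langle>y - g, \<eta>\<rangle> \<ge> \<langle>\<phi>, h\<rangle>\<close>, and the variational inequality for
  \<open>\<phi> + \<alpha> u\<close> extends from the admissible set to its contingent cone.
\<close>

section \<open>Smooth functions with compact support\<close>

text \<open>Two obstacles shape the development. First, \<open>weak_grad\<close> and
  \<open>weak_laplacian\<close> are arbitrary choices, determined only through their action on test
  functions and only up to null sets. Reading off the Laplacian of a state pointwise therefore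
  requires test functions rich enough to separate integrable functions, which is why smooth bumps
  are constructed explicitly. The final testing step needs Green's formula, the integral of grad y .
  grad v being minus that of \<Delta>y v, for every v in \<open>H10\<close>; it is proved for test
  functions and extended by density. Second, the null set in \<open>A2\<close> may depend on the two
  points compared, so the estimate cannot be evaluated at values of states that vary with x.
  Monotonicity repairs this: the estimate at rational pairs, which are countably many, already
  forces it at all pairs. Hence almost every \<open>f x\<close> is locally Lipschitz. Each single
  state is continuous on a compact set, which makes the nonlinear terms square integrable; the limit
  of the difference quotients is then identified at each point separately, with constants depending
  on that point.\<close>

text \<open>The factor \<open>poly P (1 / t)\<close> makes the family of functions exp(-c/t),
  continued by 0, closed under differentiation, so smoothness becomes an induction over arbitrary
  \<open>P\<close>.\<close>

definition exp_flat :: "real poly \<Rightarrow> real \<Rightarrow> real \<Rightarrow> real" where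
  "exp_flat P c t = (if t > 0 then poly P (1 / t) * exp (- c / t) else 0)"

lemma poly_mult_exp_tendsto_0:
  fixes P :: "real poly"
  assumes "c > 0"
  shows "((\<lambda>x. poly P x * exp (- c * x)) \<longlongrightarrow> 0) at_top"
proof -
  have pow: "((\<lambda>x. x ^ k * exp (- c * x)) \<longlongrightarrow> 0) at_top" for k :: nat
  proof -
    have "filterlim (\<lambda>x. c * x) at_top at_top"
      using assms by (intro filterlim_tendsto_pos_mult_at_top[OF tendsto_const]) (auto simp: filterlim_ident)
    from filterlim_compose[OF tendsto_power_div_exp_0 this]
    have "((\<lambda>x. (c * x) ^ k / exp (c * x)) \<longlongrightarrow> 0) at_top" .
    from tendsto_mult_left[OF this, of "1 / c ^ k"] show ?thesis
      using assms by (simp add: power_mult_distrib exp_minus field_simps)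
  qed
  have "((\<lambda>x. \<Sum>i\<le>degree P. coeff P i * (x ^ i * exp (- c * x))) \<longlongrightarrow> (\<Sum>i\<le>degree P. coeff P i * 0)) at_top"
    by (intro tendsto_sum tendsto_mult_left pow)
  then show ?thesis
    by (simp add: poly_altdef sum_distrib_right mult.assoc)
qed

lemma exp_flat_tendsto_0:
  fixes c :: real
  assumes "c > 0"
  shows "((\<lambda>t. poly P (1 / t) * exp (- c / t)) \<longlongrightarrow> 0) (at_right 0)"
  using filterlim_compose[OF poly_mult_exp_tendsto_0[OF assms, of P] filterlim_inverse_at_top_right]
  by (simp add: divide_inverse)

text \<open>With s = 1/t one has ds/dt = -s^2, so P(s) exp(-cs) has t-derivative s^2 (c P(s) -
  P'(s)) exp(-cs); the factor \<open>[:0, 0, 1:]\<close> is s^2.\<close>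

definition exp_flat_deriv :: "real \<Rightarrow> real poly \<Rightarrow> real poly" where
  "exp_flat_deriv c P = [:0, 0, 1:] * (smult c P - pderiv P)"

text \<open>Only t = 0 needs an argument: there the right difference quotient is again a member of
  the family, with polynomial \<open>[:0, 1:] * P\<close>, and exponential decay beats any
  polynomial in 1/t.\<close>

lemma exp_flat_has_derivative:
  assumes c: "c > 0"
  shows "(exp_flat P c has_real_derivative exp_flat (exp_flat_deriv c P) c t) (at t)"
proof -
  consider "t > 0" | "t < 0" | "t = 0" by linarith
  then show ?thesis
  proof cases
    case 1
    have inv: "((\<lambda>t. k / t) has_real_derivative - (k / t\<^sup>2)) (at t)" for k
      using 1 by (auto intro!: derivative_eq_intros simp: power2_eq_square)
    have "((\<lambda>t. poly P (1 / t) * exp (- c / t)) has_real_derivative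
        poly (pderiv P) (1 / t) * - (1 / t\<^sup>2) * exp (- c / t)
        + exp (- c / t) * - (- c / t\<^sup>2) * poly P (1 / t)) (at t)"
      by (intro DERIV_mult DERIV_chain2[OF poly_DERIV] DERIV_chain2[OF DERIV_exp] inv)
    also have "poly (pderiv P) (1 / t) * - (1 / t\<^sup>2) * exp (- c / t)
        + exp (- c / t) * - (- c / t\<^sup>2) * poly P (1 / t) = exp_flat (exp_flat_deriv c P) c t"
      using 1 by (simp add: exp_flat_def exp_flat_deriv_def power2_eq_square algebra_simps)
    finally have "((\<lambda>t. poly P (1 / t) * exp (- c / t)) has_real_derivative
        exp_flat (exp_flat_deriv c P) c t) (at t)" .
    then show ?thesis
      by (rule has_field_derivative_transform_within_open[of _ _ _ "{0<..}"])
        (use 1 in \<open>auto simp: exp_flat_def\<close>)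
  next
    case 2
    have "((\<lambda>t. 0) has_real_derivative exp_flat (exp_flat_deriv c P) c t) (at t)"
      using 2 by (simp add: exp_flat_def)
    then show ?thesis
      by (rule has_field_derivative_transform_within_open[of _ _ _ "{..<0}"])
        (use 2 in \<open>auto simp: exp_flat_def\<close>)
  next
    case 3
    have "((\<lambda>h. exp_flat P c h / h) \<longlongrightarrow> 0) (at_right 0)"
    proof (rule Lim_transform_eventually)
      show "((\<lambda>t. poly ([:0, 1:] * P) (1 / t) * exp (- c / t)) \<longlongrightarrow> 0) (at_right 0)"
        by (rule exp_flat_tendsto_0[OF c])
      show "\<forall>\<^sub>F x in at_right 0. poly ([:0, 1:] * P) (1 / x) * exp (- c / x) = exp_flat P c x / x"
        using eventually_at_right_less[of 0] by eventually_elim (simp add: exp_flat_def)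
    qed
    moreover have "((\<lambda>h. exp_flat P c h / h) \<longlongrightarrow> 0) (at_left 0)"
    proof (rule Lim_transform_eventually)
      show "\<forall>\<^sub>F x in at_left 0. 0 = exp_flat P c x / x"
        by (auto simp: exp_flat_def eventually_at_filter)
    qed simp
    ultimately have "((\<lambda>h. exp_flat P c h / h) \<longlongrightarrow> 0) (at 0)"
      by (simp add: filterlim_at_split)
    then show ?thesis
      using 3 by (simp add: DERIV_def exp_flat_def)
  qed
qed

section \<open>Closure properties of the classes \<open>Ck\<close>\<close>

lemma partial_deriv_eq:
  "(\<phi> has_derivative D) (at x) \<Longrightarrow> partial_deriv b \<phi> x = D b"
  unfolding partial_deriv_def by (drule frechet_derivative_at) simp

text \<open>\<open>Ck (Suc k)\<close> does not list continuity of the function itself; at the bottom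
  of the induction it comes from differentiability.\<close>

lemma Ck_SucD: "Ck (Suc k) \<phi> \<Longrightarrow> Ck k \<phi>"
proof (induction k arbitrary: \<phi>)
  case 0
  then show ?case
    by (auto intro!: differentiable_imp_continuous_on simp: differentiable_on_def)
next
  case (Suc k)
  then show ?case by simp
qed

lemma Ck_const: "Ck k (\<lambda>x::'a::euclidean_space. c)"
proof (induction k arbitrary: c)
  case (Suc k c)
  have "partial_deriv b (\<lambda>x::'a. c) = (\<lambda>x. 0)" for b
    by (rule ext) (simp add: partial_deriv_def)
  with Suc show ?case by simp
qed simp

lemma Ck_add: "Ck k \<phi> \<Longrightarrow> Ck k \<psi> \<Longrightarrow> Ck k (\<lambda>x. \<phi> x + \<psi> x)"
proof (induction k arbitrary: \<phi> \<psi>)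
  case (Suc k)
  have "partial_deriv b (\<lambda>x. \<phi> x + \<psi> x) = (\<lambda>x. partial_deriv b \<phi> x + partial_deriv b \<psi> x)" for b
  proof
    fix x
    show "partial_deriv b (\<lambda>x. \<phi> x + \<psi> x) x = partial_deriv b \<phi> x + partial_deriv b \<psi> x"
      using Suc.prems unfolding partial_deriv_def[of _ \<phi>] partial_deriv_def[of _ \<psi>]
      by (intro partial_deriv_eq[THEN trans, OF has_derivative_add])
        (auto simp: frechet_derivative_works)
  qed
  with Suc show ?case by auto
qed (auto intro: continuous_intros)

lemma partial_deriv_mult:
  assumes "\<phi> differentiable (at x)" "\<psi> differentiable (at x)"
  shows "partial_deriv b (\<lambda>x. \<phi> x * \<psi> x) x = \<phi> x * partial_deriv b \<psi> x + partial_deriv b \<phi> x * \<psi> x"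
  using assms unfolding partial_deriv_def[of _ \<phi>] partial_deriv_def[of _ \<psi>]
  by (intro partial_deriv_eq[THEN trans, OF has_derivative_mult])
    (auto simp: frechet_derivative_works)

lemma Ck_mult: "Ck k \<phi> \<Longrightarrow> Ck k \<psi> \<Longrightarrow> Ck k (\<lambda>x. \<phi> x * \<psi> x)"
proof (induction k arbitrary: \<phi> \<psi>)
  case (Suc k)
  have "partial_deriv b (\<lambda>x. \<phi> x * \<psi> x)
      = (\<lambda>x. \<phi> x * partial_deriv b \<psi> x + partial_deriv b \<phi> x * \<psi> x)" for b
    using Suc.prems by (intro ext partial_deriv_mult) auto
  moreover have "Ck k (\<lambda>x. \<phi> x * partial_deriv b \<psi> x + partial_deriv b \<phi> x * \<psi> x)" if "b \<in> Basis" for b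
    using Suc.prems that by (intro Ck_add Suc.IH) (auto intro: Ck_SucD)
  ultimately show ?case using Suc.prems by auto
qed (auto intro: continuous_intros)

lemma Ck_prod: "(\<And>i. i \<in> I \<Longrightarrow> Ck k (\<phi> i)) \<Longrightarrow> Ck k (\<lambda>x. \<Prod>i\<in>I. \<phi> i x)"
  by (induction I rule: infinite_finite_induct) (auto intro: Ck_const Ck_mult)

text \<open>A partial derivative only replaces \<open>P\<close> by a multiple of
  \<open>exp_flat_deriv c P\<close>, so the induction on k closes once \<open>P\<close> is left
  arbitrary.\<close>

lemma Ck_exp_flat:
  assumes "c > 0"
  shows "Ck k (\<lambda>x. exp_flat P c (x \<bullet> v - s))"
proof (induction k arbitrary: P)
  case 0
  have "isCont (exp_flat P c) t" for t
    using exp_flat_has_derivative[OF assms] DERIV_isCont by blast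
  then have "continuous_on UNIV (exp_flat P c)"
    by (simp add: continuous_on_eq_continuous_at)
  then show ?case
    by (auto intro!: continuous_on_compose2[of UNIV "exp_flat P c"] continuous_intros)
next
  case (Suc k)
  have D: "((\<lambda>x. exp_flat P c (x \<bullet> v - s)) has_derivative
      (\<lambda>h. exp_flat (exp_flat_deriv c P) c (x \<bullet> v - s) * (h \<bullet> v))) (at x)" for x
  proof -
    have "((\<lambda>x. x \<bullet> v - s) has_derivative (\<lambda>h. h \<bullet> v)) (at x)"
      by (auto intro!: derivative_eq_intros)
    from has_derivative_compose[OF this
        exp_flat_has_derivative[OF assms, unfolded has_field_derivative_def]]
    show ?thesis .
  qed
  have "partial_deriv b (\<lambda>x. exp_flat P c (x \<bullet> v - s))
      = (\<lambda>x. exp_flat (smult (b \<bullet> v) (exp_flat_deriv c P)) c (x \<bullet> v - s))" for b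
    by (rule ext, subst partial_deriv_eq[OF D]) (simp add: exp_flat_def)
  then show ?case
    using Suc.IH D by (auto simp: differentiable_def)
qed

text \<open>The supports shrink slightly, so that they are compact subsets of the open box.\<close>

definition box_bump :: "'a::euclidean_space \<Rightarrow> 'a \<Rightarrow> nat \<Rightarrow> 'a \<Rightarrow> real" where
  "box_bump a b n x =
     (\<Prod>i\<in>Basis. exp_flat 1 (1 / Suc n) (x \<bullet> i - (a \<bullet> i + 1 / Suc n))
               * exp_flat 1 (1 / Suc n) (x \<bullet> (- i) - (1 / Suc n - b \<bullet> i)))"

lemma box_bump_eq_0:
  assumes "x \<notin> cbox (a + (1 / Suc n) *\<^sub>R One) (b - (1 / Suc n) *\<^sub>R One)"
  shows "box_bump a b n x = 0"
proof -
  obtain i where "i \<in> Basis" "\<not> (a \<bullet> i + 1 / Suc n \<le> x \<bullet> i \<and> x \<bullet> i \<le> b \<bullet> i - 1 / Suc n)"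
    using assms by (auto simp: mem_box inner_add_left inner_diff_left)
  then show ?thesis
    unfolding box_bump_def by (intro prod_zero bexI[of _ i]) (auto simp: exp_flat_def)
qed

lemma cbox_shrink_subset_box:
  fixes a b :: "'a::euclidean_space"
  assumes "e > 0"
  shows "cbox (a + e *\<^sub>R One) (b - e *\<^sub>R One) \<subseteq> box a b"
proof
  fix x assume "x \<in> cbox (a + e *\<^sub>R One) (b - e *\<^sub>R One)"
  then have "a \<bullet> i + e \<le> x \<bullet> i \<and> x \<bullet> i \<le> b \<bullet> i - e" if "i \<in> Basis" for i
    using that by (simp add: mem_box inner_add_left inner_diff_left)
  with assms show "x \<in> box a b" by (force simp: mem_box)
qed

lemma box_bump_bounds: "0 \<le> box_bump a b n x" "box_bump a b n x \<le> 1"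
  unfolding box_bump_def
  by (auto intro!: prod_nonneg prod_le_1 mult_le_one simp: exp_flat_def)

text \<open>The number \<open>1 / Suc n\<close> is both the margin and the decay rate. Inside the
  box each factor is eventually exp(-c/s) with c tending to 0 and s to a positive limit, hence tends
  to 1; outside the open box every bump vanishes.\<close>

lemma box_bump_tendsto: "(\<lambda>n. box_bump a b n x) \<longlonglongrightarrow> indicator (box a b) x"
proof (cases "x \<in> box a b")
  case True
  \<comment> \<open>Phrased for a lower end point only: the upper end b in direction i is the lower
    end -b in direction -i.\<close>
  have *: "(\<lambda>n. exp_flat 1 (1 / real (Suc n)) (u - (v + 1 / real (Suc n)))) \<longlonglongrightarrow> 1" if "u > v" for u v
  proof (rule Lim_transform_eventually)
    have lim: "(\<lambda>n. u - (v + 1 / real (Suc n))) \<longlonglongrightarrow> u - (v + 0)"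
      by (intro tendsto_intros LIMSEQ_Suc[OF lim_1_over_n])
    have "(\<lambda>n. exp (- (1 / real (Suc n)) / (u - (v + 1 / real (Suc n))))) \<longlonglongrightarrow> exp (- 0 / (u - (v + 0)))"
      using that by (intro tendsto_intros LIMSEQ_Suc[OF lim_1_over_n]) auto
    then show "(\<lambda>n. exp (- (1 / real (Suc n)) / (u - (v + 1 / real (Suc n))))) \<longlonglongrightarrow> 1"
      by simp
    have "\<forall>\<^sub>F n in sequentially. 0 < u - (v + 1 / real (Suc n))"
      using that by (intro order_tendstoD(1)[OF lim]) auto
    then show "\<forall>\<^sub>F n in sequentially. exp (- (1 / real (Suc n)) / (u - (v + 1 / real (Suc n))))
        = exp_flat 1 (1 / real (Suc n)) (u - (v + 1 / real (Suc n)))"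
      by eventually_elim (simp add: exp_flat_def)
  qed
  have "(\<lambda>n. box_bump a b n x) \<longlonglongrightarrow> (\<Prod>i\<in>(Basis::'a set). 1 * 1)"
    unfolding box_bump_def
  proof (intro tendsto_prod tendsto_mult)
    fix i :: 'a assume "i \<in> Basis"
    with True have "a \<bullet> i < x \<bullet> i" "- (b \<bullet> i) < x \<bullet> (- i)"
      by (auto simp: mem_box)
    from *[OF this(1)] *[OF this(2)]
    show "(\<lambda>n. exp_flat 1 (1 / real (Suc n)) (x \<bullet> i - (a \<bullet> i + 1 / real (Suc n)))) \<longlonglongrightarrow> 1"
      "(\<lambda>n. exp_flat 1 (1 / real (Suc n)) (x \<bullet> (- i) - (1 / real (Suc n) - b \<bullet> i))) \<longlonglongrightarrow> 1"
      by (simp_all only: add.commute[of _ "1 / _"] uminus_add_conv_diff diff_conv_add_uminus)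
  qed
  then show ?thesis using True by simp
next
  case False
  have sub: "cbox (a + (1 / Suc n) *\<^sub>R One) (b - (1 / Suc n) *\<^sub>R One) \<subseteq> box a b" for n
    by (rule cbox_shrink_subset_box) simp
  have "box_bump a b n x = 0" for n
    using False sub[of n] by (intro box_bump_eq_0) blast
  with False show ?thesis by simp
qed

lemma test_function_box_bump:
  assumes "box a b \<subseteq> \<Omega>"
  shows "test_function \<Omega> (box_bump a b n)"
proof -
  let ?K = "cbox (a + (1 / Suc n) *\<^sub>R One) (b - (1 / Suc n) *\<^sub>R One)"
  have "{x. box_bump a b n x \<noteq> 0} \<subseteq> ?K"
    using box_bump_eq_0 by blast
  then have sub: "closure {x. box_bump a b n x \<noteq> 0} \<subseteq> ?K"
    by (intro closure_minimal closed_cbox)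
  also have "?K \<subseteq> box a b"
    by (rule cbox_shrink_subset_box) simp
  finally have "closure {x. box_bump a b n x \<noteq> 0} \<subseteq> \<Omega>"
    using assms by blast
  moreover have "compact (closure {x. box_bump a b n x \<noteq> 0})"
    using bounded_subset[OF bounded_cbox sub] by (simp add: compact_eq_bounded_closed)
  moreover have "Ck k (box_bump a b n)" for k
    unfolding box_bump_def[abs_def] by (intro Ck_prod Ck_mult Ck_exp_flat) auto
  ultimately show ?thesis
    unfolding test_function_def by blast
qed

section \<open>Elementary properties of test functions\<close>

lemma test_function_Ck: "test_function \<Omega> \<phi> \<Longrightarrow> Ck k \<phi>"
  unfolding test_function_def by blast

lemma test_function_differentiable: "test_function \<Omega> \<phi> \<Longrightarrow> \<phi> differentiable (at x)"
  using test_function_Ck[of \<Omega> \<phi> 1] by simp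

lemma test_function_continuous: "test_function \<Omega> \<phi> \<Longrightarrow> continuous_on UNIV \<phi>"
  using test_function_Ck[of \<Omega> \<phi> 0] by simp

lemma test_function_eq_0: "test_function \<Omega> \<phi> \<Longrightarrow> x \<notin> \<Omega> \<Longrightarrow> \<phi> x = 0"
  using closure_subset[of "{x. \<phi> x \<noteq> 0}"] by (auto simp: test_function_def)

lemma partial_deriv_eq_0:
  assumes "x \<notin> closure {x. \<phi> x \<noteq> 0}"
  shows "partial_deriv b \<phi> x = 0"
proof -
  have "(\<phi> has_derivative (\<lambda>_. 0)) (at x)"
  proof (rule has_derivative_transform_within_open)
    show "((\<lambda>_. 0) has_derivative (\<lambda>_. 0)) (at x)" by simp
    show "open (- closure {x. \<phi> x \<noteq> 0})" by auto
    show "x \<in> - closure {x. \<phi> x \<noteq> 0}" using assms by simp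
    show "\<And>y. y \<in> - closure {x. \<phi> x \<noteq> 0} \<Longrightarrow> 0 = \<phi> y"
      using closure_subset[of "{x. \<phi> x \<noteq> 0}"] by auto
  qed
  then show ?thesis by (rule partial_deriv_eq)
qed

lemma test_function_partial_deriv:
  assumes "test_function \<Omega> \<phi>" "b \<in> Basis"
  shows "test_function \<Omega> (partial_deriv b \<phi>)"
proof -
  have "closure {x. partial_deriv b \<phi> x \<noteq> 0} \<subseteq> closure {x. \<phi> x \<noteq> 0}"
    using partial_deriv_eq_0 by (intro closure_minimal) auto
  moreover from this have "compact (closure {x. partial_deriv b \<phi> x \<noteq> 0})"
    using assms(1) unfolding test_function_def compact_eq_bounded_closed
    by (auto intro: bounded_subset)
  moreover have "Ck k (partial_deriv b \<phi>)" for k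
    using test_function_Ck[OF assms(1), of "Suc k"] assms(2) by simp
  ultimately show ?thesis
    using assms unfolding test_function_def by blast
qed

lemma test_function_bounded:
  assumes "test_function \<Omega> \<phi>"
  obtains B where "\<And>x. \<bar>\<phi> x\<bar> \<le> B"
proof -
  have "compact (\<phi> ` closure {x. \<phi> x \<noteq> 0})"
    using assms test_function_continuous[OF assms] unfolding test_function_def
    by (meson compact_continuous_image continuous_on_subset subset_UNIV)
  then obtain B where B: "\<And>y. y \<in> \<phi> ` closure {x. \<phi> x \<noteq> 0} \<Longrightarrow> \<bar>y\<bar> \<le> B"
    by (metis bounded_iff compact_imp_bounded real_norm_def)
  \<comment> \<open>If the support is empty, \<open>B\<close> is unconstrained and may be
    negative.\<close>
  have "\<bar>\<phi> x\<bar> \<le> max B 0" for x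
  proof (cases "\<phi> x = 0")
    case False
    then show ?thesis using B[of "\<phi> x"] closure_subset[of "{x. \<phi> x \<noteq> 0}"] by fastforce
  qed simp
  with that show ?thesis by blast
qed

section \<open>The fundamental lemma and integration by parts\<close>

lemma borel_measurable_lebesgue_on_of_borel:
  "f \<in> borel_measurable borel \<Longrightarrow> f \<in> borel_measurable (lebesgue_on \<Omega>)"
  by (intro measurable_restrict_space1 measurable_completion) simp

lemma test_function_borel: "test_function \<Omega> \<phi> \<Longrightarrow> \<phi> \<in> borel_measurable borel"
  by (intro borel_measurable_continuous_onI test_function_continuous)

lemmas test_function_measurable =
  borel_measurable_lebesgue_on_of_borel[OF test_function_borel]

lemma integrable_mult_test_function:
  assumes "integrable (lebesgue_on \<Omega>) w" "test_function \<Omega>' \<phi>"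
  shows "integrable (lebesgue_on \<Omega>) (\<lambda>x. w x * \<phi> x)"
proof -
  obtain B where B: "\<And>x. \<bar>\<phi> x\<bar> \<le> B" using test_function_bounded[OF assms(2)] by blast
  have [measurable]: "\<phi> \<in> borel_measurable (lebesgue_on \<Omega>)"
    "w \<in> borel_measurable (lebesgue_on \<Omega>)"
    using assms test_function_measurable by auto
  have "integrable (lebesgue_on \<Omega>) (\<lambda>x. B * w x)" using assms by simp
  then show ?thesis
  proof (rule Bochner_Integration.integrable_bound)
    have "\<bar>w x * \<phi> x\<bar> \<le> \<bar>B * w x\<bar>" for x
      using B[of x] by (simp add: abs_mult) (metis abs_ge_self abs_ge_zero mult.commute mult_right_mono order_trans)
    then show "AE x in lebesgue_on \<Omega>. norm (w x * \<phi> x) \<le> norm (B * w x)" by simp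
  qed measurable
qed

text \<open>The bumps converge to the indicator of the box with values in [0, 1], so \<bar>w\<bar>
  dominates and orthogonality passes to the limit.\<close>

lemma integral_box_eq_0:
  assumes w: "integrable (lebesgue_on \<Omega>) w"
    and orth: "\<And>\<phi>. test_function \<Omega> \<phi> \<Longrightarrow> (\<integral>x. w x * \<phi> x \<partial>lebesgue_on \<Omega>) = 0"
    and box: "box a b \<subseteq> \<Omega>"
  shows "(LINT x:box a b|lebesgue_on \<Omega>. w x) = 0"
proof -
  have [measurable]: "w \<in> borel_measurable (lebesgue_on \<Omega>)" using w by simp
  have [measurable]: "box_bump a b n \<in> borel_measurable (lebesgue_on \<Omega>)" for n
    by (rule test_function_measurable[OF test_function_box_bump[OF box]])
  have ind[measurable]: "(indicator (box a b) :: 'a \<Rightarrow> real) \<in> borel_measurable (lebesgue_on \<Omega>)"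
    by (intro borel_measurable_lebesgue_on_of_borel) simp
  have "(\<lambda>n. \<integral>x. w x * box_bump a b n x \<partial>lebesgue_on \<Omega>)
      \<longlonglongrightarrow> (\<integral>x. w x * indicator (box a b) x \<partial>lebesgue_on \<Omega>)"
  proof (rule integral_dominated_convergence)
    show "integrable (lebesgue_on \<Omega>) (\<lambda>x. \<bar>w x\<bar>)" using w by simp
    show "AE x in lebesgue_on \<Omega>. (\<lambda>n. w x * box_bump a b n x) \<longlonglongrightarrow> w x * indicator (box a b) x"
      by (intro AE_I2 tendsto_mult tendsto_const box_bump_tendsto)
    show "AE x in lebesgue_on \<Omega>. norm (w x * box_bump a b n x) \<le> \<bar>w x\<bar>" for n
      using box_bump_bounds[of a b n]
      by (intro AE_I2) (simp add: abs_mult mult_left_le)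
  qed measurable
  then have "(\<integral>x. w x * indicator (box a b) x \<partial>lebesgue_on \<Omega>) = 0"
    using orth test_function_box_bump[OF box] by (simp add: LIMSEQ_const_iff)
  then show ?thesis
    by (simp add: set_lebesgue_integral_def mult.commute)
qed

text \<open>A pi-lambda argument: boxes are an intersection-stable generator of the Borel sets.
  Cutting with one fixed box inside \<Omega> guarantees that each generator yields a box contained
  in \<Omega>, where the previous lemma applies.\<close>

lemma set_integral_borel_box_eq_0:
  assumes w: "integrable (lebesgue_on \<Omega>) w"
    and orth: "\<And>\<phi>. test_function \<Omega> \<phi> \<Longrightarrow> (\<integral>x. w x * \<phi> x \<partial>lebesgue_on \<Omega>) = 0"
    and box: "box a b \<subseteq> \<Omega>" and A: "A \<in> sets borel" and \<Omega>: "\<Omega> \<in> sets lebesgue"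
  shows "(LINT x:A \<inter> box a b|lebesgue_on \<Omega>. w x) = 0"
proof -
  let ?G = "range (\<lambda>(a, b). box a b :: 'a set)" and ?B = "box a b"
  have meas: "A \<inter> ?B \<in> sets (lebesgue_on \<Omega>)" if "A \<in> sets borel" for A
  proof -
    have "A \<inter> ?B \<in> sets lebesgue" using that by (intro sets_completionI_sets) simp
    then show ?thesis using box \<Omega> by (auto simp: sets_restrict_space_iff)
  qed
  have int: "set_integrable (lebesgue_on \<Omega>) A w" if "A \<in> sets (lebesgue_on \<Omega>)" for A
    unfolding set_integrable_def using w that by (rule integrable_mult_indicator[rotated])
  have Int_stable: "Int_stable ?G"
    unfolding Int_stable_def by (auto simp: box_Int_box)
  have sub: "sigma_sets UNIV ?G = sets borel"
    by (simp add: borel_eq_box)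
  have A: "A \<in> sigma_sets UNIV ?G" using A sub by simp
  show ?thesis
    using Int_stable subset_UNIV[of "?G", unfolded Pow_UNIV[symmetric]] A
  proof (induction A rule: sigma_sets_induct_disjoint)
    case (basic A)
    then obtain c d where "A = box c d" by auto
    then obtain e g where eg: "A \<inter> ?B = box e g" using box_Int_box by blast
    then have "box e g \<subseteq> \<Omega>" using box by blast
    from integral_box_eq_0[OF w orth this] show ?case by (simp add: eg)
  next
    case empty
    then show ?case by (simp add: set_lebesgue_integral_def)
  next
    case (compl A)
    then have A: "A \<in> sets borel" using sub by simp
    have "(LINT x:?B|lebesgue_on \<Omega>. w x)
        = (LINT x:(UNIV - A) \<inter> ?B|lebesgue_on \<Omega>. w x) + (LINT x:A \<inter> ?B|lebesgue_on \<Omega>. w x)"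
    proof -
      have "?B = ((UNIV - A) \<inter> ?B) \<union> (A \<inter> ?B)" by auto
      also have "(LINT x:\<dots>|lebesgue_on \<Omega>. w x)
          = (LINT x:(UNIV - A) \<inter> ?B|lebesgue_on \<Omega>. w x) + (LINT x:A \<inter> ?B|lebesgue_on \<Omega>. w x)"
        using A by (intro set_integral_Un int meas) auto
      finally show ?thesis .
    qed
    with compl integral_box_eq_0[OF w orth box] show ?case by simp
  next
    case (union A)
    have A: "A i \<in> sets borel" for i using union(2) sub by auto
    have "(LINT x:(\<Union>i. A i \<inter> ?B)|lebesgue_on \<Omega>. w x) = (\<Sum>i. LINT x:A i \<inter> ?B|lebesgue_on \<Omega>. w x)"
      using union(1) A
      by (intro lebesgue_integral_countable_add int meas sets.countable_UN)
        (auto simp: disjoint_family_on_def meas)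
    then show ?case using union by (simp add: Int_UN_distrib2)
  qed
qed

text \<open>On each box inside \<Omega> the function has zero integral over every measurable set, so
  it vanishes there almost everywhere; countably many such boxes exhaust \<Omega>.\<close>

theorem AE_eq_0_of_test_functions:
  fixes w :: "'a::euclidean_space \<Rightarrow> real"
  assumes "open \<Omega>" "bounded \<Omega>" and w: "integrable (lebesgue_on \<Omega>) w"
    and orth: "\<And>\<phi>. test_function \<Omega> \<phi> \<Longrightarrow> (\<integral>x. w x * \<phi> x \<partial>lebesgue_on \<Omega>) = 0"
  shows "AE x in lebesgue_on \<Omega>. w x = 0"
proof -
  have \<Omega>: "\<Omega> \<in> sets lebesgue" using assms(1) by (intro sets_completionI_sets) simp
  have on_box: "AE x in lebesgue_on \<Omega>. x \<in> box a b \<longrightarrow> w x = 0" if box: "box a b \<subseteq> \<Omega>" for a b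
  proof -
    interpret finite_measure "lebesgue_on \<Omega>"
      using assms(1,2) by (intro finite_measure_lebesgue_on lmeasurable_open)
    have B: "box a b \<in> sets (lebesgue_on \<Omega>)"
      using box \<Omega> by (auto simp: sets_restrict_space_iff intro!: sets_completionI_sets)
    have "AE x in lebesgue_on \<Omega>. indicator (box a b) x *\<^sub>R w x = 0"
    proof (rule density_zero)
      show "integrable (lebesgue_on \<Omega>) (\<lambda>x. indicat_real (box a b) x *\<^sub>R w x)"
        using B w by (rule integrable_mult_indicator)
      fix A assume "A \<in> sets (lebesgue_on \<Omega>)"
      then have A: "A \<in> sets lebesgue" "A \<subseteq> \<Omega>" using \<Omega> by (auto simp: sets_restrict_space_iff)
      \<comment> \<open>\<open>density_zero\<close> asks for all Lebesgue measurable sets, while the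
        pi-lambda argument covers Borel ones. The main part is Borel and agrees with
        \<open>A\<close> up to a null set.\<close>
      let ?A = "main_part lborel A"
      have "?A \<in> sets borel" using main_part_sets[OF A(1)] by simp
      have "AE x in lebesgue_on \<Omega>. x \<in> ?A \<longleftrightarrow> x \<in> A"
        unfolding AE_restrict_space_iff[of \<Omega> lebesgue, simplified, OF \<Omega>]
        using AE_completion[OF AE_in_main_part[OF A(1)]] by eventually_elim simp
      then have "(\<integral>x. indicat_real A x *\<^sub>R (indicat_real (box a b) x *\<^sub>R w x) \<partial>lebesgue_on \<Omega>)
          = (\<integral>x. indicat_real (?A \<inter> box a b) x *\<^sub>R w x \<partial>lebesgue_on \<Omega>)"
      proof (intro integral_cong_AE)
        show "(\<lambda>x. indicat_real A x *\<^sub>R (indicat_real (box a b) x *\<^sub>R w x)) \<in> borel_measurable (lebesgue_on \<Omega>)"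
          using \<open>A \<in> sets (lebesgue_on \<Omega>)\<close> B w
          by (intro borel_measurable_scaleR borel_measurable_indicator) auto
        show "(\<lambda>x. indicat_real (?A \<inter> box a b) x *\<^sub>R w x) \<in> borel_measurable (lebesgue_on \<Omega>)"
          using \<open>?A \<in> sets borel\<close> borel_measurable_integrable[OF w]
          by (intro borel_measurable_scaleR borel_measurable_lebesgue_on_of_borel[of "indicat_real _"]
                borel_measurable_indicator) auto
        assume "AE x in lebesgue_on \<Omega>. x \<in> ?A \<longleftrightarrow> x \<in> A"
        then show "AE x in lebesgue_on \<Omega>. indicat_real A x *\<^sub>R (indicat_real (box a b) x *\<^sub>R w x)
            = indicat_real (?A \<inter> box a b) x *\<^sub>R w x"
          by eventually_elim (auto simp: indicator_def)
      qed
      also have "\<dots> = 0"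
        using set_integral_borel_box_eq_0[OF w orth box \<open>?A \<in> sets borel\<close> \<Omega>]
        by (simp add: set_lebesgue_integral_def)
      finally show "(LINT x:A|lebesgue_on \<Omega>. indicat_real (box a b) x *\<^sub>R w x) = 0"
        by (simp add: set_lebesgue_integral_def)
    qed
    then show ?thesis by eventually_elim (auto simp: indicator_def)
  qed
  \<comment> \<open>Encodes boxes by the coordinates of their corners; rational corners keep the
    cover of the open set \<Omega> countable.\<close>
  define c d where "c = (\<lambda>f :: 'a \<Rightarrow> real \<times> real. \<Sum>i\<in>Basis. fst (f i) *\<^sub>R i)"
    and "d = (\<lambda>f :: 'a \<Rightarrow> real \<times> real. \<Sum>i\<in>Basis. snd (f i) *\<^sub>R i)"
  define I where "I = {f \<in> (Basis :: 'a set) \<rightarrow>\<^sub>E \<rat> \<times> \<rat>. box (c f) (d f) \<subseteq> \<Omega>}"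
  have cover: "\<Omega> = (\<Union>f\<in>I. box (c f) (d f))"
    using open_UNION_box[OF \<open>open \<Omega>\<close>] unfolding I_def c_def d_def by simp
  have "countable I"
    unfolding I_def
    by (rule countable_subset[of _ "(Basis :: 'a set) \<rightarrow>\<^sub>E \<rat> \<times> \<rat>"])
      (auto intro!: countable_PiE countable_SIGMA countable_rat)
  then have "AE x in lebesgue_on \<Omega>. \<forall>f\<in>I. x \<in> box (c f) (d f) \<longrightarrow> w x = 0"
    by (subst AE_ball_countable) (auto intro!: on_box simp: I_def)
  then show ?thesis
    by (rule lebesgue_on_mono) (use cover in auto)
qed

section \<open>Integration by parts for test functions\<close>

text \<open>Moves integrals from \<Omega> to the whole space, where translation invariance is
  available.\<close>

lemma test_function_integral_lborel:
  assumes "test_function \<Omega> \<phi>" "\<Omega> \<in> sets lebesgue"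
  shows "(\<integral>x. \<phi> x \<partial>lebesgue_on \<Omega>) = (\<integral>x. \<phi> x \<partial>lborel)"
proof -
  have "(\<lambda>x. if x \<in> \<Omega> then \<phi> x else 0) = \<phi>"
    using test_function_eq_0[OF assms(1)] by auto
  then show ?thesis
    using Lebesgue_Measure.integral_restrict_UNIV[OF assms(2), of \<phi>] test_function_borel[OF assms(1)]
    by (simp add: integral_completion)
qed

lemma test_function_integrable_lborel:
  assumes "test_function \<Omega> \<phi>"
  shows "integrable lborel \<phi>"
proof -
  let ?K = "closure {x. \<phi> x \<noteq> 0}"
  have "integrable lborel (\<lambda>x. indicat_real ?K x *\<^sub>R \<phi> x)"
    using assms test_function_continuous[OF assms]
    by (intro borel_integrable_compact) (auto simp: test_function_def intro: continuous_on_subset)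
  moreover have "(\<lambda>x. indicat_real ?K x *\<^sub>R \<phi> x) = \<phi>"
    using closure_subset[of "{x. \<phi> x \<noteq> 0}"] by (fastforce simp: indicator_def)
  ultimately show ?thesis by simp
qed

lemma test_function_has_derivative_along:
  assumes "test_function \<Omega> \<phi>"
  shows "((\<lambda>t. \<phi> (x + t *\<^sub>R b)) has_real_derivative partial_deriv b \<phi> (x + t *\<^sub>R b)) (at t)"
proof -
  have "((\<lambda>t. x + t *\<^sub>R b) has_derivative (\<lambda>h. h *\<^sub>R b)) (at t)"
    by (auto intro!: derivative_eq_intros)
  moreover have "(\<phi> has_derivative frechet_derivative \<phi> (at (x + t *\<^sub>R b))) (at (x + t *\<^sub>R b))"
    using test_function_differentiable[OF assms] by (simp add: frechet_derivative_works)
  ultimately have D: "((\<lambda>t. \<phi> (x + t *\<^sub>R b)) has_derivative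
      (\<lambda>h. frechet_derivative \<phi> (at (x + t *\<^sub>R b)) (h *\<^sub>R b))) (at t)"
    by (rule has_derivative_compose)
  have "linear (frechet_derivative \<phi> (at (x + t *\<^sub>R b)))"
    using test_function_differentiable[OF assms] by (rule linear_frechet_derivative)
  then have "(\<lambda>h. frechet_derivative \<phi> (at (x + t *\<^sub>R b)) (h *\<^sub>R b)) = (*) (partial_deriv b \<phi> (x + t *\<^sub>R b))"
    by (auto simp: partial_deriv_def linear_scale mult.commute)
  with D show ?thesis by (simp add: has_field_derivative_def)
qed

text \<open>Translation invariance of the integral, applied to difference quotients.\<close>

lemma integral_partial_deriv_eq_0:
  fixes \<phi> :: "'a::euclidean_space \<Rightarrow> real"
  assumes \<phi>: "test_function \<Omega> \<phi>" and b: "b \<in> Basis"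
  shows "(\<integral>x. partial_deriv b \<phi> x \<partial>lborel) = 0"
proof -
  note d\<phi> = test_function_partial_deriv[OF \<phi> b]
  obtain B where B: "\<And>x. \<bar>partial_deriv b \<phi> x\<bar> \<le> B" using test_function_bounded[OF d\<phi>] by blast
  have "bounded (closure {x. \<phi> x \<noteq> 0})"
    using \<phi> compact_imp_bounded unfolding test_function_def by blast
  then obtain R where R: "\<And>x. x \<in> closure {x. \<phi> x \<noteq> 0} \<Longrightarrow> norm x \<le> R"
    unfolding bounded_iff by blast
  have \<phi>0: "\<phi> x = 0" if "norm x > R" for x
    using R[of x] closure_subset[of "{x. \<phi> x \<noteq> 0}"] that by force
  define h where "h n = 1 / real (Suc n)" for n
  have h: "0 < h n" "h n \<le> 1" for n by (auto simp: h_def)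
  have h0: "h \<longlonglongrightarrow> 0" unfolding h_def by (rule LIMSEQ_Suc[OF lim_1_over_n])
  have [measurable]: "\<phi> \<in> borel_measurable borel" "partial_deriv b \<phi> \<in> borel_measurable borel"
    using test_function_borel \<phi> d\<phi> by auto
  have shift: "integrable lborel (\<lambda>x. \<phi> (c + x))" "(\<integral>x. \<phi> (c + x) \<partial>lborel) = (\<integral>x. \<phi> x \<partial>lborel)" for c
    using test_function_integrable_lborel[OF \<phi>]
      integrable_distr_eq[of "(+) c" lborel borel \<phi>] integral_distr[of "(+) c" lborel borel \<phi>]
    by (simp_all add: lborel_distr_plus)
  have "(\<lambda>n. \<integral>x. (\<phi> (x + h n *\<^sub>R b) - \<phi> x) / h n \<partial>lborel) \<longlonglongrightarrow> (\<integral>x. partial_deriv b \<phi> x \<partial>lborel)"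
  proof (rule integral_dominated_convergence)
    \<comment> \<open>The margin 1 absorbs the shift: \<open>h n \<le> 1\<close> and
      \<open>b\<close> has norm 1, so outside this ball both x and the shifted point miss the
      support. Inside, the mean value theorem gives the bound \<open>B\<close>.\<close>
    show "integrable lborel (\<lambda>x. B * indicat_real (cball (0 :: 'a) (R + 1)) x)"
      using borel_integrable_compact[of "cball (0 :: 'a) (R + 1)" "\<lambda>x. B"]
      by (simp add: mult.commute)
    have "(\<lambda>n. (\<phi> (x + h n *\<^sub>R b) - \<phi> x) / h n) \<longlonglongrightarrow> partial_deriv b \<phi> x" for x
    proof -
      have "((\<lambda>t. (\<phi> (x + t *\<^sub>R b) - \<phi> x) / t) \<longlongrightarrow> partial_deriv b \<phi> x) (at 0)"
        using test_function_has_derivative_along[OF \<phi>, of x b 0] by (simp add: DERIV_def)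
      moreover have "filterlim h (at 0) sequentially"
        using h0 h by (auto simp: filterlim_at less_imp_neq[symmetric])
      ultimately show ?thesis by (rule filterlim_compose)
    qed
    then show "AE x in lborel. (\<lambda>n. (\<phi> (x + h n *\<^sub>R b) - \<phi> x) / h n) \<longlonglongrightarrow> partial_deriv b \<phi> x"
      by simp
    have "\<bar>(\<phi> (x + h n *\<^sub>R b) - \<phi> x) / h n\<bar> \<le> B * indicat_real (cball 0 (R + 1)) x" for n x
    proof (cases "norm x \<le> R + 1")
      case True
      obtain t where "\<phi> (x + h n *\<^sub>R b) - \<phi> (x + 0 *\<^sub>R b) = (h n - 0) * partial_deriv b \<phi> (x + t *\<^sub>R b)"
        using MVT2[of 0 "h n" "\<lambda>t. \<phi> (x + t *\<^sub>R b)" "\<lambda>t. partial_deriv b \<phi> (x + t *\<^sub>R b)"] h(1) test_function_has_derivative_along[OF \<phi>] by blast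
      with True B h(1)[of n] show ?thesis by (simp add: abs_mult)
    next
      case False
      have "norm x \<le> norm (x + h n *\<^sub>R b) + norm (h n *\<^sub>R b)"
        using norm_triangle_ineq4[of "x + h n *\<^sub>R b" "h n *\<^sub>R b"] by simp
      moreover have "norm (h n *\<^sub>R b) \<le> 1" using h[of n] b by simp
      ultimately have "\<phi> (x + h n *\<^sub>R b) = 0" "\<phi> x = 0"
        using False by (auto intro!: \<phi>0)
      with False show ?thesis by simp
    qed
    then show "AE x in lborel. norm ((\<phi> (x + h n *\<^sub>R b) - \<phi> x) / h n) \<le> B * indicat_real (cball 0 (R + 1)) x" for n
      by simp
  qed measurable
  moreover have "(\<integral>x. (\<phi> (x + h n *\<^sub>R b) - \<phi> x) / h n \<partial>lborel) = 0" for n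
    using shift[of "h n *\<^sub>R b"] test_function_integrable_lborel[OF \<phi>] by (simp add: add.commute)
  ultimately have "(\<lambda>n::nat. 0) \<longlonglongrightarrow> (\<integral>x. partial_deriv b \<phi> x \<partial>lborel)"
    by (simp only:)
  then show ?thesis by (simp add: LIMSEQ_const_iff)
qed

lemma test_function_mult:
  assumes "test_function \<Omega> \<phi>" "test_function \<Omega>' \<psi>"
  shows "test_function \<Omega> (\<lambda>x. \<phi> x * \<psi> x)"
proof -
  have sub: "closure {x. \<phi> x * \<psi> x \<noteq> 0} \<subseteq> closure {x. \<phi> x \<noteq> 0}"
    by (intro closure_mono) auto
  then have "compact (closure {x. \<phi> x * \<psi> x \<noteq> 0})"
    using assms(1) unfolding test_function_def compact_eq_bounded_closed
    by (auto intro: bounded_subset)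
  moreover have "Ck k (\<lambda>x. \<phi> x * \<psi> x)" for k
    using assms by (intro Ck_mult) (auto simp: test_function_Ck)
  moreover have "closure {x. \<phi> x * \<psi> x \<noteq> 0} \<subseteq> \<Omega>"
    using assms(1) sub unfolding test_function_def by auto
  ultimately show ?thesis
    unfolding test_function_def by blast
qed

text \<open>The product of the two functions is a test function, so its partial derivative
  integrates to 0; the product rule splits that integral.\<close>

lemma test_function_integration_by_parts:
  assumes \<Omega>: "\<Omega> \<in> sets lebesgue" and \<phi>: "test_function \<Omega> \<phi>" and \<psi>: "test_function \<Omega> \<psi>" and b: "b \<in> Basis"
  shows "(\<integral>x. \<phi> x * partial_deriv b \<psi> x \<partial>lebesgue_on \<Omega>)
    = - (\<integral>x. partial_deriv b \<phi> x * \<psi> x \<partial>lebesgue_on \<Omega>)"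
proof -
  note d = test_function_partial_deriv[OF _ b]
  note t1 = test_function_mult[OF \<phi> d[OF \<psi>]] and t2 = test_function_mult[OF d[OF \<phi>] \<psi>]
  have "0 = (\<integral>x. \<phi> x * partial_deriv b \<psi> x + partial_deriv b \<phi> x * \<psi> x \<partial>lborel)"
    using integral_partial_deriv_eq_0[OF test_function_mult[OF \<phi> \<psi>] b]
      test_function_differentiable[OF \<phi>] test_function_differentiable[OF \<psi>]
    by (simp add: partial_deriv_mult)
  then show ?thesis
    using test_function_integrable_lborel[OF t1] test_function_integrable_lborel[OF t2]
      test_function_integral_lborel[OF t1 \<Omega>] test_function_integral_lborel[OF t2 \<Omega>]
    by simp
qed

section \<open>Lebesgue spaces\<close>

text \<open>The crude constant from s + t \<le> 2 max(s, t) is enough, as the estimate only serves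
  to show that \<open>Lp\<close> is closed under addition.\<close>

lemma add_powr_le:
  fixes s t p :: real
  assumes "0 \<le> s" "0 \<le> t" "0 \<le> p"
  shows "(s + t) powr p \<le> 2 powr p * (s powr p + t powr p)"
proof -
  have "(s + t) powr p \<le> (2 * max s t) powr p"
    using assms by (intro powr_mono2) auto
  also have "\<dots> = 2 powr p * max s t powr p"
    using assms by (simp add: powr_mult)
  also have "\<dots> \<le> 2 powr p * (s powr p + t powr p)"
    by (auto simp: max_def)
  finally show ?thesis .
qed

lemma Lp_add:
  assumes "u \<in> Lp \<Omega> p" "v \<in> Lp \<Omega> p" "0 \<le> p"
  shows "(\<lambda>x. u x + v x) \<in> Lp \<Omega> p"
proof -
  have [measurable]: "u \<in> borel_measurable (lebesgue_on \<Omega>)" "v \<in> borel_measurable (lebesgue_on \<Omega>)"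
    using assms by (auto simp: Lp_def)
  have "integrable (lebesgue_on \<Omega>) (\<lambda>x. norm (u x + v x) powr p)"
  proof (rule Bochner_Integration.integrable_bound)
    show "integrable (lebesgue_on \<Omega>) (\<lambda>x. 2 powr p * (norm (u x) powr p + norm (v x) powr p))"
      using assms by (auto simp: Lp_def)
    have "norm (u x + v x) powr p \<le> 2 powr p * (norm (u x) powr p + norm (v x) powr p)" for x
    proof -
      have "norm (u x + v x) powr p \<le> (norm (u x) + norm (v x)) powr p"
        using assms by (intro powr_mono2 norm_triangle_ineq) auto
      also have "\<dots> \<le> 2 powr p * (norm (u x) powr p + norm (v x) powr p)"
        using assms by (intro add_powr_le) auto
      finally show ?thesis .
    qed
    then show "AE x in lebesgue_on \<Omega>. norm (norm (u x + v x) powr p)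
        \<le> norm (2 powr p * (norm (u x) powr p + norm (v x) powr p))"
      by (auto intro!: AE_I2)
  qed measurable
  then show ?thesis by (simp add: Lp_def)
qed

lemma Lp_scaleR: "u \<in> Lp \<Omega> p \<Longrightarrow> (\<lambda>x. c *\<^sub>R u x) \<in> Lp \<Omega> p"
  by (auto simp: Lp_def powr_mult)

lemma Lp_diff: "u \<in> Lp \<Omega> p \<Longrightarrow> v \<in> Lp \<Omega> p \<Longrightarrow> 0 \<le> p \<Longrightarrow> (\<lambda>x. u x - v x) \<in> Lp \<Omega> p"
  using Lp_add[of u \<Omega> p "\<lambda>x. - 1 *\<^sub>R v x"] Lp_scaleR[of v \<Omega> p "- 1"] by simp

lemma Lp_mult: "u \<in> Lp \<Omega> p \<Longrightarrow> (\<lambda>x. c * u x :: real) \<in> Lp \<Omega> p"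
  using Lp_scaleR[of u \<Omega> p c] by simp

lemma Lp2_iff:
  "u \<in> Lp \<Omega> 2 \<longleftrightarrow> u \<in> borel_measurable (lebesgue_on \<Omega>) \<and> integrable (lebesgue_on \<Omega>) (\<lambda>x. (norm (u x))\<^sup>2)"
  by (simp add: Lp_def)

lemma Lp_norm_2_eq: "Lp_norm \<Omega> 2 u = sqrt (\<integral>x. (norm (u x))\<^sup>2 \<partial>lebesgue_on \<Omega>)"
  by (simp add: Lp_norm_def powr_half_sqrt)

lemma abs_inner_le_sum_squares: "\<bar>u \<bullet> v\<bar> \<le> (norm u)\<^sup>2 + (norm v)\<^sup>2"
proof -
  have "\<bar>u \<bullet> v\<bar> \<le> norm u * norm v" by (rule Cauchy_Schwarz_ineq2)
  also have "norm u * norm v \<le> (norm u)\<^sup>2 + (norm v)\<^sup>2"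
    using sum_squares_bound[of "norm u" "norm v"] mult_nonneg_nonneg[OF norm_ge_zero norm_ge_zero, of u v]
    by linarith
  finally show ?thesis .
qed

lemma Lp2_inner_integrable:
  assumes "u \<in> Lp \<Omega> 2" "v \<in> Lp \<Omega> 2"
  shows "integrable (lebesgue_on \<Omega>) (\<lambda>x. u x \<bullet> v x)"
proof (rule Bochner_Integration.integrable_bound)
  show "integrable (lebesgue_on \<Omega>) (\<lambda>x. (norm (u x))\<^sup>2 + (norm (v x))\<^sup>2)"
    using assms by (simp add: Lp2_iff)
  show "AE x in lebesgue_on \<Omega>. norm (u x \<bullet> v x) \<le> norm ((norm (u x))\<^sup>2 + (norm (v x))\<^sup>2)"
    using abs_inner_le_sum_squares by (auto intro!: AE_I2)
  show "(\<lambda>x. u x \<bullet> v x) \<in> borel_measurable (lebesgue_on \<Omega>)"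
    using assms by (intro borel_measurable_inner) (auto simp: Lp2_iff)
qed

lemma Lp2_mult_integrable:
  fixes u v :: "'a::euclidean_space \<Rightarrow> real"
  shows "u \<in> Lp \<Omega> 2 \<Longrightarrow> v \<in> Lp \<Omega> 2 \<Longrightarrow> integrable (lebesgue_on \<Omega>) (\<lambda>x. u x * v x)"
  using Lp2_inner_integrable[of u \<Omega> v] by simp

text \<open>The square norm of s u + v is a nonnegative polynomial in s. Evaluation at its minimiser
  -B/A gives the bound when A > 0; when A = 0 it is affine, so its slope must vanish.\<close>

lemma Lp2_Cauchy_Schwarz:
  assumes u: "u \<in> Lp \<Omega> 2" and v: "v \<in> Lp \<Omega> 2"
  shows "\<bar>\<integral>x. u x \<bullet> v x \<partial>lebesgue_on \<Omega>\<bar> \<le> Lp_norm \<Omega> 2 u * Lp_norm \<Omega> 2 v"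
proof -
  let ?A = "\<integral>x. (norm (u x))\<^sup>2 \<partial>lebesgue_on \<Omega>" and ?B = "\<integral>x. u x \<bullet> v x \<partial>lebesgue_on \<Omega>"
    and ?C = "\<integral>x. (norm (v x))\<^sup>2 \<partial>lebesgue_on \<Omega>"
  have quad: "0 \<le> ?A * s\<^sup>2 + 2 * ?B * s + ?C" for s
  proof -
    have "0 \<le> (\<integral>x. (norm (s *\<^sub>R u x + v x))\<^sup>2 \<partial>lebesgue_on \<Omega>)"
      by (intro Bochner_Integration.integral_nonneg) simp
    also have "\<dots> = (\<integral>x. s\<^sup>2 * (norm (u x))\<^sup>2 + 2 * s * (u x \<bullet> v x) + (norm (v x))\<^sup>2 \<partial>lebesgue_on \<Omega>)"
    proof -
      have "(norm (s *\<^sub>R u x + v x))\<^sup>2 = s\<^sup>2 * (norm (u x))\<^sup>2 + 2 * s * (u x \<bullet> v x) + (norm (v x))\<^sup>2" for x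
        unfolding power2_norm_eq_inner
        by (simp add: inner_add_left inner_add_right inner_commute power2_eq_square algebra_simps)
      then show ?thesis by (simp only:)
    qed
    also have "\<dots> = s\<^sup>2 * ?A + 2 * s * ?B + ?C"
      using u v Lp2_inner_integrable[OF u v] by (simp add: Lp2_iff)
    finally show ?thesis by (simp add: algebra_simps)
  qed
  have A: "0 \<le> ?A" and C: "0 \<le> ?C" by (auto intro!: Bochner_Integration.integral_nonneg)
  have "?B\<^sup>2 \<le> ?A * ?C"
  proof (cases "?A = 0")
    case True
    have "?B = 0"
    proof (rule ccontr)
      assume "?B \<noteq> 0"
      \<comment> \<open>At this s the affine function 2 B s + C takes the value -1.\<close>
      then show False using quad[of "- (?C + 1) / (2 * ?B)"] True by (simp add: field_simps)
    qed
    then show ?thesis using True by simp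
  next
    case False
    with A have "0 < ?A" by linarith
    have "0 \<le> ?A * (?A * (- ?B / ?A)\<^sup>2 + 2 * ?B * (- ?B / ?A) + ?C)"
      using A quad by (intro mult_nonneg_nonneg)
    also have "\<dots> = ?A * ?C - ?B\<^sup>2"
      using \<open>0 < ?A\<close> by (simp add: field_simps power2_eq_square)
    finally show ?thesis by simp
  qed
  then have "sqrt (?B\<^sup>2) \<le> sqrt (?A * ?C)" by (rule real_sqrt_le_mono)
  then show ?thesis by (simp add: Lp_norm_2_eq real_sqrt_mult)
qed

lemma Lp2_inner_tendsto:
  assumes un: "\<And>n. un n \<in> Lp \<Omega> 2" and u: "u \<in> Lp \<Omega> 2" and v: "v \<in> Lp \<Omega> 2"
    and lim: "(\<lambda>n. Lp_norm \<Omega> 2 (\<lambda>x. un n x - u x)) \<longlonglongrightarrow> 0"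
  shows "(\<lambda>n. \<integral>x. v x \<bullet> un n x \<partial>lebesgue_on \<Omega>) \<longlonglongrightarrow> (\<integral>x. v x \<bullet> u x \<partial>lebesgue_on \<Omega>)"
proof -
  have "(\<lambda>n. (\<integral>x. v x \<bullet> un n x \<partial>lebesgue_on \<Omega>) - (\<integral>x. v x \<bullet> u x \<partial>lebesgue_on \<Omega>)) \<longlonglongrightarrow> 0"
  proof (rule Lim_null_comparison)
    show "(\<lambda>n. Lp_norm \<Omega> 2 v * Lp_norm \<Omega> 2 (\<lambda>x. un n x - u x)) \<longlonglongrightarrow> 0"
      using tendsto_mult_left[OF lim] by simp
    have "(\<integral>x. v x \<bullet> un n x \<partial>lebesgue_on \<Omega>) - (\<integral>x. v x \<bullet> u x \<partial>lebesgue_on \<Omega>)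
        = (\<integral>x. v x \<bullet> (un n x - u x) \<partial>lebesgue_on \<Omega>)" for n
      using Lp2_inner_integrable[OF v un] Lp2_inner_integrable[OF v u] by (simp add: inner_diff_right)
    then show "\<forall>\<^sub>F n in sequentially. norm ((\<integral>x. v x \<bullet> un n x \<partial>lebesgue_on \<Omega>) - (\<integral>x. v x \<bullet> u x \<partial>lebesgue_on \<Omega>))
        \<le> Lp_norm \<Omega> 2 v * Lp_norm \<Omega> 2 (\<lambda>x. un n x - u x)"
      using Lp2_Cauchy_Schwarz[OF v Lp_diff[OF un u]] by (auto intro!: always_eventually)
  qed
  then show ?thesis by (simp add: LIM_zero_iff)
qed

section \<open>Embeddings on bounded domains\<close>

lemma bounded_in_Lp:
  fixes v :: "'a::euclidean_space \<Rightarrow> 'b::euclidean_space"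
  assumes \<Omega>: "open \<Omega>" "bounded \<Omega>" and v: "v \<in> borel_measurable (lebesgue_on \<Omega>)"
    and B: "AE x in lebesgue_on \<Omega>. norm (v x) \<le> B" and "0 \<le> p"
  shows "v \<in> Lp \<Omega> p"
proof -
  interpret finite_measure "lebesgue_on \<Omega>"
    using \<Omega> by (intro finite_measure_lebesgue_on lmeasurable_open)
  have "integrable (lebesgue_on \<Omega>) (\<lambda>x. norm (v x) powr p)"
  proof (rule integrable_const_bound[where B = "B powr p"])
    show "AE x in lebesgue_on \<Omega>. norm (norm (v x) powr p) \<le> B powr p"
      using B by eventually_elim (auto intro!: powr_mono2 \<open>0 \<le> p\<close>)
  qed (use v in measurable)
  with v show ?thesis by (simp add: Lp_def)
qed

text \<open>Splitting at the threshold e plays the role of Hoelder's inequality: above it, s^(2-p)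
  \<le> e^(2-p) because 2 - p \<le> 0. The choice e = 1 yields the inclusion of \<open>Lp\<close> in
  L2, small e the convergence statement.\<close>

lemma power2_le_powr:
  fixes s p e :: real
  assumes "0 \<le> s" "2 \<le> p" "0 < e"
  shows "s\<^sup>2 \<le> e\<^sup>2 + e powr (2 - p) * s powr p"
proof (cases "s \<le> e")
  case True
  then have "s\<^sup>2 \<le> e\<^sup>2" using assms by (intro power_mono)
  then show ?thesis by (simp add: add_increasing2)
next
  case False
  then have "s\<^sup>2 = s powr (2 - p) * s powr p"
    using assms by (simp flip: powr_add)
  also have "\<dots> \<le> e powr (2 - p) * s powr p"
    using assms False by (intro mult_right_mono powr_mono2') auto
  finally show ?thesis by (simp add: add_increasing)
qed

lemma Lp_subset_Lp2:
  assumes \<Omega>: "open \<Omega>" "bounded \<Omega>" and "2 \<le> p" and u: "u \<in> Lp \<Omega> p"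
  shows "u \<in> Lp \<Omega> 2"
proof -
  interpret finite_measure "lebesgue_on \<Omega>"
    using \<Omega> by (intro finite_measure_lebesgue_on lmeasurable_open)
  have meas[measurable]: "u \<in> borel_measurable (lebesgue_on \<Omega>)" using u by (simp add: Lp_def)
  have "integrable (lebesgue_on \<Omega>) (\<lambda>x. (norm (u x))\<^sup>2)"
  proof (rule Bochner_Integration.integrable_bound)
    show "integrable (lebesgue_on \<Omega>) (\<lambda>x. 1 + norm (u x) powr p)"
      using u by (simp add: Lp_def)
    show "AE x in lebesgue_on \<Omega>. norm ((norm (u x))\<^sup>2) \<le> norm (1 + norm (u x) powr p)"
      using power2_le_powr[OF norm_ge_zero \<open>2 \<le> p\<close>, of 1] by (auto intro!: AE_I2)
  qed measurable
  then show ?thesis by (simp add: Lp2_iff)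
qed

lemma Lp_tendsto_imp_Lp2_tendsto:
  assumes \<Omega>: "open \<Omega>" "bounded \<Omega>" and p: "2 \<le> p" and v: "\<And>n. v n \<in> Lp \<Omega> p"
    and lim: "(\<lambda>n. Lp_norm \<Omega> p (v n)) \<longlonglongrightarrow> 0"
  shows "(\<lambda>n. Lp_norm \<Omega> 2 (v n)) \<longlonglongrightarrow> 0"
proof -
  interpret finite_measure "lebesgue_on \<Omega>"
    using \<Omega> by (intro finite_measure_lebesgue_on lmeasurable_open)
  let ?m = "measure (lebesgue_on \<Omega>) (space (lebesgue_on \<Omega>))"
  let ?I = "\<lambda>n. \<integral>x. norm (v n x) powr p \<partial>lebesgue_on \<Omega>"
  have "(\<lambda>n. Lp_norm \<Omega> p (v n) powr p) \<longlonglongrightarrow> 0 powr p"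
    using lim p by (intro tendsto_powr' tendsto_const) (auto simp: Lp_norm_def)
  then have I: "?I \<longlonglongrightarrow> 0"
    using p by (simp add: Lp_norm_def powr_powr Bochner_Integration.integral_nonneg)
  have "(\<lambda>n. \<integral>x. (norm (v n x))\<^sup>2 \<partial>lebesgue_on \<Omega>) \<longlonglongrightarrow> 0"
  proof (rule LIMSEQ_I)
    fix r :: real assume "0 < r"
    \<comment> \<open>Makes \<open>e\<^sup>2 * ?m\<close> at most r/2, the added 1 avoiding division
      by a zero measure. With e fixed, the other term is small for large n.\<close>
    define e where "e = sqrt (r / (2 * (?m + 1)))"
    have "0 < e" using \<open>0 < r\<close> by (simp add: e_def add_nonneg_pos)
    have "e\<^sup>2 * ?m \<le> r / 2"
    proof -
      have "e\<^sup>2 * ?m = r / 2 * (?m / (?m + 1))"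
        using \<open>0 < r\<close> by (simp add: e_def add_nonneg_pos field_simps)
      also have "\<dots> \<le> r / 2 * 1"
        using \<open>0 < r\<close> by (intro mult_left_mono) (auto simp: divide_le_eq_1 add_nonneg_pos)
      finally show ?thesis by simp
    qed
    have "(\<lambda>n. e powr (2 - p) * ?I n) \<longlonglongrightarrow> e powr (2 - p) * 0"
      by (intro tendsto_mult_left I)
    then have "\<forall>\<^sub>F n in sequentially. e powr (2 - p) * ?I n < r / 2"
      using \<open>0 < r\<close> by (intro order_tendstoD(2)) auto
    then obtain N where N: "\<And>n. n \<ge> N \<Longrightarrow> e powr (2 - p) * ?I n < r / 2"
      by (auto simp: eventually_sequentially)
    have bound: "(\<integral>x. (norm (v n x))\<^sup>2 \<partial>lebesgue_on \<Omega>) \<le> e\<^sup>2 * ?m + e powr (2 - p) * ?I n" for n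
    proof -
      have int: "integrable (lebesgue_on \<Omega>) (\<lambda>x. norm (v n x) powr p)"
        using v by (simp add: Lp_def)
      have "(\<integral>x. (norm (v n x))\<^sup>2 \<partial>lebesgue_on \<Omega>)
          \<le> (\<integral>x. e\<^sup>2 + e powr (2 - p) * norm (v n x) powr p \<partial>lebesgue_on \<Omega>)"
        using Lp_subset_Lp2[OF \<Omega> p v[of n]] int power2_le_powr[OF norm_ge_zero p \<open>0 < e\<close>]
        by (intro integral_mono) (auto simp: Lp2_iff)
      also have "\<dots> = e\<^sup>2 * ?m + e powr (2 - p) * ?I n"
        using int by simp
      finally show ?thesis .
    qed
    have nonneg: "0 \<le> (\<integral>x. (norm (v n x))\<^sup>2 \<partial>lebesgue_on \<Omega>)" for n
      by (intro Bochner_Integration.integral_nonneg) simp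
    have "norm ((\<integral>x. (norm (v n x))\<^sup>2 \<partial>lebesgue_on \<Omega>) - 0) < r" if "n \<ge> N" for n
    proof -
      have "(\<integral>x. (norm (v n x))\<^sup>2 \<partial>lebesgue_on \<Omega>) < r / 2 + r / 2"
        by (rule order.strict_trans1[OF bound
              add_le_less_mono[OF \<open>e\<^sup>2 * ?m \<le> r / 2\<close> N[OF that]]])
      with nonneg[of n] show ?thesis
        by (simp only: diff_zero real_norm_def abs_of_nonneg field_sum_of_halves)
    qed
    then show "\<exists>N. \<forall>n\<ge>N. norm ((\<integral>x. (norm (v n x))\<^sup>2 \<partial>lebesgue_on \<Omega>) - 0) < r" by blast
  qed
  from tendsto_real_sqrt[OF this] show ?thesis by (simp add: Lp_norm_2_eq)
qed

lemma test_function_in_Lp: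
  assumes "open \<Omega>" "bounded \<Omega>" "test_function \<Omega>' \<phi>" "0 \<le> p"
  shows "\<phi> \<in> Lp \<Omega> p"
proof -
  obtain B where "\<And>x. \<bar>\<phi> x\<bar> \<le> B" using test_function_bounded[OF assms(3)] by blast
  with assms show ?thesis
    by (intro bounded_in_Lp[of _ _ B]) (auto intro: test_function_measurable)
qed

lemma Lp2_integrable:
  fixes u :: "'a::euclidean_space \<Rightarrow> real"
  assumes "open \<Omega>" "bounded \<Omega>" "u \<in> Lp \<Omega> 2"
  shows "integrable (lebesgue_on \<Omega>) u"
  using Lp2_mult_integrable[of u \<Omega> "\<lambda>x. 1"] bounded_in_Lp[of \<Omega> "\<lambda>x. 1 :: real" 1 2] assms by simp

section \<open>Weak gradients and Laplacians\<close>

text \<open>The fundamental lemma, coordinate by coordinate. It is the means of computing with the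
  chosen representative \<open>weak_grad\<close>.\<close>

lemma is_weak_grad_AE_unique:
  assumes \<Omega>: "open \<Omega>" "bounded \<Omega>" and G: "is_weak_grad \<Omega> y G" and G': "is_weak_grad \<Omega> y G'"
  shows "AE x in lebesgue_on \<Omega>. G x = G' x"
proof -
  have L2: "G \<in> Lp \<Omega> 2" "G' \<in> Lp \<Omega> 2" using G G' by (auto simp: is_weak_grad_def)
  have b2: "(\<lambda>x. b) \<in> Lp \<Omega> 2" for b :: 'a
    using \<Omega> by (intro bounded_in_Lp[of _ _ "norm b"]) auto
  have "AE x in lebesgue_on \<Omega>. (G x - G' x) \<bullet> b = 0" if b: "b \<in> Basis" for b
  proof (rule AE_eq_0_of_test_functions[OF \<Omega>])
    show "integrable (lebesgue_on \<Omega>) (\<lambda>x. (G x - G' x) \<bullet> b)"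
      using Lp2_inner_integrable[OF Lp_diff[OF L2] b2] by simp
    fix \<phi> assume \<phi>: "test_function \<Omega> \<phi>"
    have "integrable (lebesgue_on \<Omega>) (\<lambda>x. (H x \<bullet> b) * \<phi> x)" if "H \<in> Lp \<Omega> 2" for H
      using Lp2_inner_integrable[OF that b2] \<phi> by (intro integrable_mult_test_function)
    with L2 G G' \<phi> b show "(\<integral>x. (G x - G' x) \<bullet> b * \<phi> x \<partial>lebesgue_on \<Omega>) = 0"
      by (simp add: is_weak_grad_def inner_diff_left left_diff_distrib)
  qed
  then have "AE x in lebesgue_on \<Omega>. \<forall>b\<in>Basis. (G x - G' x) \<bullet> b = 0"
    by (intro AE_finite_allI) auto
  then show ?thesis
    by eventually_elim (metis euclidean_all_zero_iff right_minus_eq)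
qed

lemma is_weak_laplacian_AE_unique:
  assumes \<Omega>: "open \<Omega>" "bounded \<Omega>" and w: "is_weak_laplacian \<Omega> y w" and w': "is_weak_laplacian \<Omega> y w'"
  shows "AE x in lebesgue_on \<Omega>. w x = w' x"
proof -
  have int: "integrable (lebesgue_on \<Omega>) w" "integrable (lebesgue_on \<Omega>) w'"
    using w w' \<Omega> by (auto simp: is_weak_laplacian_def intro: Lp2_integrable)
  have "AE x in lebesgue_on \<Omega>. w x - w' x = 0"
  proof (rule AE_eq_0_of_test_functions[OF \<Omega>])
    fix \<phi> assume "test_function \<Omega> \<phi>"
    with w w' int show "(\<integral>x. (w x - w' x) * \<phi> x \<partial>lebesgue_on \<Omega>) = 0"
      by (simp add: is_weak_laplacian_def left_diff_distrib integrable_mult_test_function)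
  qed (use int in simp)
  then show ?thesis by simp
qed

lemma weak_grad_spec: "y \<in> H1 \<Omega> \<Longrightarrow> is_weak_grad \<Omega> y (weak_grad \<Omega> y)"
  unfolding H1_def weak_grad_def by (auto intro: someI[of "is_weak_grad \<Omega> y"])

lemma weak_grad_Lp2: "y \<in> H1 \<Omega> \<Longrightarrow> weak_grad \<Omega> y \<in> Lp \<Omega> 2"
  using weak_grad_spec by (auto simp: is_weak_grad_def)

lemma H1_Lp2: "y \<in> H1 \<Omega> \<Longrightarrow> y \<in> Lp \<Omega> 2"
  by (simp add: H1_def)

lemma H10_H1: "y \<in> H10 \<Omega> \<Longrightarrow> y \<in> H1 \<Omega>"
  by (simp add: H10_def)

lemma Y_space_H1: "y \<in> Y_space \<Omega> \<Longrightarrow> y \<in> H1 \<Omega>"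
  by (simp add: Y_space_def H10_H1)

lemma weak_laplacian_spec:
  "is_weak_laplacian \<Omega> y w \<Longrightarrow> is_weak_laplacian \<Omega> y (weak_laplacian \<Omega> y)"
  unfolding weak_laplacian_def by (rule someI[of "is_weak_laplacian \<Omega> y"])

lemma Y_space_weak_laplacian:
  "y \<in> Y_space \<Omega> \<Longrightarrow> is_weak_laplacian \<Omega> y (weak_laplacian \<Omega> y)"
  using weak_laplacian_spec by (auto simp: Y_space_def)

section \<open>Linearity of weak derivatives\<close>

lemma is_weak_grad_diff:
  assumes \<Omega>: "open \<Omega>" "bounded \<Omega>" and y: "y \<in> Lp \<Omega> 2" "z \<in> Lp \<Omega> 2"
    and G: "is_weak_grad \<Omega> y G" "is_weak_grad \<Omega> z H"
  shows "is_weak_grad \<Omega> (\<lambda>x. y x - z x) (\<lambda>x. G x - H x)"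
  unfolding is_weak_grad_def
proof (intro conjI allI impI ballI)
  have L2: "G \<in> Lp \<Omega> 2" "H \<in> Lp \<Omega> 2" using G by (auto simp: is_weak_grad_def)
  then show "(\<lambda>x. G x - H x) \<in> Lp \<Omega> 2" by (intro Lp_diff) auto
  fix \<phi> and b :: 'a assume \<phi>: "test_function \<Omega> \<phi>" and b: "b \<in> Basis"
  have "(\<lambda>x. b) \<in> Lp \<Omega> 2"
    using \<Omega> by (intro bounded_in_Lp[of _ _ "norm b"]) auto
  then have "integrable (lebesgue_on \<Omega>) (\<lambda>x. (H x \<bullet> b) * \<phi> x)" if "H \<in> Lp \<Omega> 2" for H
    using Lp2_inner_integrable[OF that] \<phi> by (intro integrable_mult_test_function)
  moreover have "integrable (lebesgue_on \<Omega>) (\<lambda>x. y x * partial_deriv b \<phi> x)" if "y \<in> Lp \<Omega> 2" for y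
    using Lp2_integrable[OF \<Omega> that] test_function_partial_deriv[OF \<phi> b]
    by (intro integrable_mult_test_function)
  ultimately show "(\<integral>x. (y x - z x) * partial_deriv b \<phi> x \<partial>lebesgue_on \<Omega>)
      = - (\<integral>x. (G x - H x) \<bullet> b * \<phi> x \<partial>lebesgue_on \<Omega>)"
    using y L2 G \<phi> b by (simp add: is_weak_grad_def inner_diff_left left_diff_distrib)
qed

lemma is_weak_grad_cmult:
  assumes "is_weak_grad \<Omega> y G"
  shows "is_weak_grad \<Omega> (\<lambda>x. c * y x) (\<lambda>x. c *\<^sub>R G x)"
  using assms Lp_scaleR[of G \<Omega> 2 c] by (simp add: is_weak_grad_def mult.assoc)

lemma test_function_sum_Basis_laplacian:
  assumes \<phi>: "test_function \<Omega> \<phi>" and y: "integrable (lebesgue_on \<Omega>) y"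
  shows "integrable (lebesgue_on \<Omega>) (\<lambda>x. y x * (\<Sum>b\<in>Basis. partial_deriv b (partial_deriv b \<phi>) x))"
  unfolding sum_distrib_left
  by (intro Bochner_Integration.integrable_sum integrable_mult_test_function[OF y, of \<Omega>]
      test_function_partial_deriv \<phi>)

lemma is_weak_laplacian_diff:
  assumes \<Omega>: "open \<Omega>" "bounded \<Omega>" and y: "y \<in> Lp \<Omega> 2" "z \<in> Lp \<Omega> 2"
    and G: "is_weak_laplacian \<Omega> y v" "is_weak_laplacian \<Omega> z w"
  shows "is_weak_laplacian \<Omega> (\<lambda>x. y x - z x) (\<lambda>x. v x - w x)"
  unfolding is_weak_laplacian_def
proof (intro conjI allI impI)
  have L2: "v \<in> Lp \<Omega> 2" "w \<in> Lp \<Omega> 2" using G by (auto simp: is_weak_laplacian_def)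
  then show "(\<lambda>x. v x - w x) \<in> Lp \<Omega> 2" by (intro Lp_diff) auto
  fix \<phi> assume \<phi>: "test_function \<Omega> \<phi>"
  have "integrable (lebesgue_on \<Omega>) (\<lambda>x. w x * \<phi> x)"
    "integrable (lebesgue_on \<Omega>) (\<lambda>x. w x * (\<Sum>b\<in>Basis. partial_deriv b (partial_deriv b \<phi>) x))"
    if "w \<in> Lp \<Omega> 2" for w
    using Lp2_integrable[OF \<Omega> that] \<phi>
    by (auto intro: integrable_mult_test_function test_function_sum_Basis_laplacian)
  with y L2 G \<phi> show "(\<integral>x. (y x - z x) * (\<Sum>b\<in>Basis. partial_deriv b (partial_deriv b \<phi>) x) \<partial>lebesgue_on \<Omega>)
      = (\<integral>x. (v x - w x) * \<phi> x \<partial>lebesgue_on \<Omega>)"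
    by (simp add: is_weak_laplacian_def left_diff_distrib)
qed

lemma is_weak_laplacian_cmult:
  assumes "is_weak_laplacian \<Omega> y w"
  shows "is_weak_laplacian \<Omega> (\<lambda>x. c * y x) (\<lambda>x. c * w x)"
  using assms Lp_mult[of w \<Omega> 2 c] by (simp add: is_weak_laplacian_def mult.assoc)

section \<open>Test functions as Sobolev functions\<close>

lemma test_function_is_weak_grad:
  assumes \<Omega>: "open \<Omega>" "bounded \<Omega>" and \<phi>: "test_function \<Omega> \<phi>"
  shows "is_weak_grad \<Omega> \<phi> (\<lambda>x. \<Sum>b\<in>Basis. partial_deriv b \<phi> x *\<^sub>R b)"
  unfolding is_weak_grad_def
proof (intro conjI allI impI ballI)
  let ?G = "\<lambda>x. \<Sum>b\<in>Basis. partial_deriv b \<phi> x *\<^sub>R b"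
  have d: "partial_deriv b \<phi> \<in> Lp \<Omega> 2" if "b \<in> Basis" for b
    using test_function_partial_deriv[OF \<phi> that] \<Omega> by (intro test_function_in_Lp) auto
  have norm_G: "(norm (?G x))\<^sup>2 = (\<Sum>b\<in>Basis. (norm (partial_deriv b \<phi> x))\<^sup>2)" for x
    unfolding power2_norm_eq_inner euclidean_inner[of "?G x" "?G x"]
    by (intro sum.cong refl) simp
  show "?G \<in> Lp \<Omega> 2"
    unfolding Lp2_iff norm_G using d
    by (auto simp: Lp2_iff intro!: borel_measurable_sum borel_measurable_scaleR)
  fix \<psi> and b :: 'a assume "test_function \<Omega> \<psi>" "b \<in> Basis"
  then show "(\<integral>x. \<phi> x * partial_deriv b \<psi> x \<partial>lebesgue_on \<Omega>)
      = - (\<integral>x. (?G x \<bullet> b) * \<psi> x \<partial>lebesgue_on \<Omega>)"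
    using test_function_integration_by_parts[OF _ \<phi>] \<Omega>
    by simp
qed

lemma test_function_in_H1:
  assumes \<Omega>: "open \<Omega>" "bounded \<Omega>" and \<phi>: "test_function \<Omega> \<phi>"
  shows "\<phi> \<in> H1 \<Omega>"
  using test_function_is_weak_grad[OF assms] test_function_in_Lp[OF assms, of 2]
  by (auto simp: H1_def)

text \<open>Even the gradient of the zero function is a choice. Its vanishing almost everywhere is
  what lets a constant sequence witness that test functions lie in \<open>H10\<close>.\<close>

lemma weak_grad_0_AE:
  assumes \<Omega>: "open \<Omega>" "bounded \<Omega>"
  shows "AE x in lebesgue_on \<Omega>. weak_grad \<Omega> (\<lambda>x. 0) x = 0"
proof (rule is_weak_grad_AE_unique[OF \<Omega>])
  show 0: "is_weak_grad \<Omega> (\<lambda>x. 0) (\<lambda>x. 0)"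
    by (simp add: is_weak_grad_def Lp_def)
  then show "is_weak_grad \<Omega> (\<lambda>x. 0) (weak_grad \<Omega> (\<lambda>x. 0))"
    by (intro weak_grad_spec) (auto simp: H1_def Lp_def)
qed

lemma test_function_in_H10:
  assumes \<Omega>: "open \<Omega>" "bounded \<Omega>" and \<phi>: "test_function \<Omega> \<phi>"
  shows "\<phi> \<in> H10 \<Omega>"
proof -
  have "(\<integral>x. (norm (weak_grad \<Omega> (\<lambda>x. 0) x))\<^sup>2 \<partial>lebesgue_on \<Omega>) = 0"
    using weak_grad_0_AE[OF \<Omega>] by (intro integral_eq_zero_AE) auto
  then have "H1_norm \<Omega> (\<lambda>x. \<phi> x - \<phi> x) = 0"
    by (simp add: H1_norm_def Lp_norm_2_eq)
  with test_function_in_H1[OF assms] \<phi> show ?thesis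
    unfolding H10_def by (auto intro!: exI[of _ "\<lambda>n. \<phi>"])
qed

section \<open>Green's formula and the pointwise form of weak equations\<close>

text \<open>Each partial derivative of \<phi> is itself a test function, so it may be inserted into
  the definition of the weak gradient of y; summing over the basis produces the Laplacian of \<phi>,
  on which the weak Laplacian of y is tested.\<close>

lemma weak_grad_inner_test_function:
  assumes \<Omega>: "open \<Omega>" "bounded \<Omega>" and y: "y \<in> H1 \<Omega>" and w: "is_weak_laplacian \<Omega> y w"
    and \<phi>: "test_function \<Omega> \<phi>"
  shows "(\<integral>x. weak_grad \<Omega> y x \<bullet> weak_grad \<Omega> \<phi> x \<partial>lebesgue_on \<Omega>)
    = - (\<integral>x. w x * \<phi> x \<partial>lebesgue_on \<Omega>)"
proof -
  note G = weak_grad_spec[OF y] and d = test_function_partial_deriv[OF \<phi>]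
  have L2: "weak_grad \<Omega> y \<in> Lp \<Omega> 2" using G by (simp add: is_weak_grad_def)
  let ?G = "\<lambda>x. \<Sum>b\<in>Basis. partial_deriv b \<phi> x *\<^sub>R b"
  have G\<phi>: "is_weak_grad \<Omega> \<phi> ?G" by (rule test_function_is_weak_grad[OF \<Omega> \<phi>])
  then have "?G \<in> Lp \<Omega> 2" by (simp add: is_weak_grad_def)
  have G\<phi>': "is_weak_grad \<Omega> \<phi> (weak_grad \<Omega> \<phi>)"
    by (rule weak_grad_spec[OF test_function_in_H1[OF \<Omega> \<phi>]])
  have "(\<integral>x. weak_grad \<Omega> y x \<bullet> weak_grad \<Omega> \<phi> x \<partial>lebesgue_on \<Omega>) = (\<integral>x. weak_grad \<Omega> y x \<bullet> ?G x \<partial>lebesgue_on \<Omega>)"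
  proof (rule integral_cong_AE)
    show "AE x in lebesgue_on \<Omega>. weak_grad \<Omega> y x \<bullet> weak_grad \<Omega> \<phi> x = weak_grad \<Omega> y x \<bullet> ?G x"
      using is_weak_grad_AE_unique[OF \<Omega> G\<phi>' G\<phi>] by eventually_elim simp
  qed (use L2 G\<phi>' \<open>?G \<in> _\<close> in \<open>auto simp: Lp2_iff is_weak_grad_def intro!: borel_measurable_inner\<close>)
  also have "\<dots> = (\<integral>x. (\<Sum>b\<in>Basis. (weak_grad \<Omega> y x \<bullet> b) * partial_deriv b \<phi> x) \<partial>lebesgue_on \<Omega>)"
    by (simp add: inner_sum_right mult.commute)
  also have "\<dots> = (\<Sum>b\<in>Basis. \<integral>x. (weak_grad \<Omega> y x \<bullet> b) * partial_deriv b \<phi> x \<partial>lebesgue_on \<Omega>)"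
  proof (rule Bochner_Integration.integral_sum)
    fix b :: 'a assume b: "b \<in> Basis"
    have "(\<lambda>x. b) \<in> Lp \<Omega> 2"
      using \<Omega> by (intro bounded_in_Lp[of _ _ "norm b"]) auto
    from Lp2_inner_integrable[OF L2 this] d[OF b]
    show "integrable (lebesgue_on \<Omega>) (\<lambda>x. (weak_grad \<Omega> y x \<bullet> b) * partial_deriv b \<phi> x)"
      by (rule integrable_mult_test_function)
  qed
  also have "\<dots> = (\<Sum>b\<in>Basis. - (\<integral>x. y x * partial_deriv b (partial_deriv b \<phi>) x \<partial>lebesgue_on \<Omega>))"
  proof (rule sum.cong[OF refl])
    fix b :: 'a assume b: "b \<in> Basis"
    show "(\<integral>x. (weak_grad \<Omega> y x \<bullet> b) * partial_deriv b \<phi> x \<partial>lebesgue_on \<Omega>)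
        = - (\<integral>x. y x * partial_deriv b (partial_deriv b \<phi>) x \<partial>lebesgue_on \<Omega>)"
      using G b d[OF b] by (simp add: is_weak_grad_def)
  qed
  also have "\<dots> = - (\<integral>x. y x * (\<Sum>b\<in>Basis. partial_deriv b (partial_deriv b \<phi>) x) \<partial>lebesgue_on \<Omega>)"
  proof -
    have "integrable (lebesgue_on \<Omega>) (\<lambda>x. y x * partial_deriv b (partial_deriv b \<phi>) x)" if "b \<in> Basis" for b
      using Lp2_integrable[OF \<Omega> H1_Lp2[OF y]] test_function_partial_deriv[OF d that] that
      by (intro integrable_mult_test_function)
    then show ?thesis
      by (simp add: sum_distrib_left sum_negf Bochner_Integration.integral_sum)
  qed
  also have "\<dots> = - (\<integral>x. w x * \<phi> x \<partial>lebesgue_on \<Omega>)"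
    using w \<phi> by (simp add: is_weak_laplacian_def)
  finally show ?thesis .
qed

lemma weak_grad_diff_AE:
  assumes \<Omega>: "open \<Omega>" "bounded \<Omega>" and y: "y \<in> H1 \<Omega>" and z: "z \<in> H1 \<Omega>"
  shows "AE x in lebesgue_on \<Omega>. weak_grad \<Omega> (\<lambda>x. y x - z x) x = weak_grad \<Omega> y x - weak_grad \<Omega> z x"
    and "(\<lambda>x. y x - z x) \<in> H1 \<Omega>"
proof -
  have D: "is_weak_grad \<Omega> (\<lambda>x. y x - z x) (\<lambda>x. weak_grad \<Omega> y x - weak_grad \<Omega> z x)"
    by (intro is_weak_grad_diff \<Omega> weak_grad_spec H1_Lp2 y z)
  then show H1: "(\<lambda>x. y x - z x) \<in> H1 \<Omega>"
    using Lp_diff[OF H1_Lp2[OF y] H1_Lp2[OF z]] by (auto simp: H1_def)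
  show "AE x in lebesgue_on \<Omega>. weak_grad \<Omega> (\<lambda>x. y x - z x) x = weak_grad \<Omega> y x - weak_grad \<Omega> z x"
    by (rule is_weak_grad_AE_unique[OF \<Omega> weak_grad_spec[OF H1] D])
qed

text \<open>Both sides are continuous in v for the H1 norm, by Cauchy-Schwarz, and test functions
  are dense in \<open>H10\<close> by definition.\<close>

lemma weak_grad_inner_H10:
  assumes \<Omega>: "open \<Omega>" "bounded \<Omega>" and y: "y \<in> H1 \<Omega>" and w: "is_weak_laplacian \<Omega> y w"
    and v: "v \<in> H10 \<Omega>"
  shows "(\<integral>x. weak_grad \<Omega> y x \<bullet> weak_grad \<Omega> v x \<partial>lebesgue_on \<Omega>)
    = - (\<integral>x. w x * v x \<partial>lebesgue_on \<Omega>)"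
proof -
  obtain \<phi> where \<phi>: "\<And>n. test_function \<Omega> (\<phi> n)"
    and lim: "(\<lambda>n. H1_norm \<Omega> (\<lambda>x. \<phi> n x - v x)) \<longlonglongrightarrow> 0"
    using v by (auto simp: H10_def)
  have H1: "\<phi> n \<in> H1 \<Omega>" "v \<in> H1 \<Omega>" for n
    using \<phi> \<Omega> v by (auto intro: test_function_in_H1 H10_H1)
  have w2: "w \<in> Lp \<Omega> 2" using w by (simp add: is_weak_laplacian_def)
  have le: "norm (Lp_norm \<Omega> 2 u) \<le> H1_norm \<Omega> u"
    "norm (Lp_norm \<Omega> 2 (weak_grad \<Omega> u)) \<le> H1_norm \<Omega> u" for u
    unfolding H1_norm_def real_norm_def by (auto intro!: real_le_rsqrt)
  have "(\<lambda>n. Lp_norm \<Omega> 2 (\<lambda>x. \<phi> n x - v x)) \<longlonglongrightarrow> 0"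
    by (rule Lim_null_comparison[OF always_eventually lim]) (rule allI, rule le(1))
  then have "(\<lambda>n. \<integral>x. w x \<bullet> \<phi> n x \<partial>lebesgue_on \<Omega>) \<longlonglongrightarrow> (\<integral>x. w x \<bullet> v x \<partial>lebesgue_on \<Omega>)"
    using H1 by (intro Lp2_inner_tendsto w2 H1_Lp2)
  then have "(\<lambda>n. - (\<integral>x. w x * \<phi> n x \<partial>lebesgue_on \<Omega>)) \<longlonglongrightarrow> - (\<integral>x. w x * v x \<partial>lebesgue_on \<Omega>)"
    by (intro tendsto_minus) simp
  then have 1: "(\<lambda>n. \<integral>x. weak_grad \<Omega> y x \<bullet> weak_grad \<Omega> (\<phi> n) x \<partial>lebesgue_on \<Omega>)
      \<longlonglongrightarrow> - (\<integral>x. w x * v x \<partial>lebesgue_on \<Omega>)"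
    using weak_grad_inner_test_function[OF \<Omega> y w \<phi>] by simp
  \<comment> \<open>The gradient of a difference and the difference of gradients are separate
    choices, equal only almost everywhere; the norms agree nevertheless.\<close>
  have eq: "Lp_norm \<Omega> 2 (\<lambda>x. weak_grad \<Omega> (\<phi> n) x - weak_grad \<Omega> v x)
      = Lp_norm \<Omega> 2 (weak_grad \<Omega> (\<lambda>x. \<phi> n x - v x))" for n
    unfolding Lp_norm_2_eq
  proof (intro arg_cong[where f = sqrt] integral_cong_AE)
    show "AE x in lebesgue_on \<Omega>. (norm (weak_grad \<Omega> (\<phi> n) x - weak_grad \<Omega> v x))\<^sup>2
        = (norm (weak_grad \<Omega> (\<lambda>x. \<phi> n x - v x) x))\<^sup>2"
      using weak_grad_diff_AE(1)[OF \<Omega> H1(1)[of n] H1(2)] by eventually_elim simp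
  qed (use weak_grad_Lp2[OF H1(1)[of n]] weak_grad_Lp2[OF H1(2)]
        weak_grad_Lp2[OF weak_grad_diff_AE(2)[OF \<Omega> H1(1)[of n] H1(2)]] in
      \<open>auto simp: Lp2_iff\<close>)
  have "(\<lambda>n. Lp_norm \<Omega> 2 (\<lambda>x. weak_grad \<Omega> (\<phi> n) x - weak_grad \<Omega> v x)) \<longlonglongrightarrow> 0"
    unfolding eq
    by (rule Lim_null_comparison[OF always_eventually lim]) (rule allI, rule le(2))
  then have "(\<lambda>n. \<integral>x. weak_grad \<Omega> y x \<bullet> weak_grad \<Omega> (\<phi> n) x \<partial>lebesgue_on \<Omega>)
      \<longlonglongrightarrow> (\<integral>x. weak_grad \<Omega> y x \<bullet> weak_grad \<Omega> v x \<partial>lebesgue_on \<Omega>)"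
    using H1 y by (intro Lp2_inner_tendsto weak_grad_Lp2)
  from LIMSEQ_unique[OF this 1] show ?thesis .
qed

text \<open>Test functions are admissible in the variational equation, so Green's formula and the
  fundamental lemma turn it into a pointwise one.\<close>

lemma weak_solution_laplacian_AE:
  assumes \<Omega>: "open \<Omega>" "bounded \<Omega>" and y: "y \<in> Y_space \<Omega>" and q: "q \<in> Lp \<Omega> 2" and F: "F \<in> Lp \<Omega> 2"
    and sol: "weak_solution \<Omega> y q F"
  shows "AE x in lebesgue_on \<Omega>. weak_laplacian \<Omega> y x = q x - F x"
proof -
  note w = Y_space_weak_laplacian[OF y]
  have L2: "weak_laplacian \<Omega> y \<in> Lp \<Omega> 2" using w by (simp add: is_weak_laplacian_def)
  have int: "integrable (lebesgue_on \<Omega>) u" if "u \<in> Lp \<Omega> 2" for u :: "'a \<Rightarrow> real"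
    using that \<Omega> by (intro Lp2_integrable)
  have "AE x in lebesgue_on \<Omega>. weak_laplacian \<Omega> y x - (q x - F x) = 0"
  proof (rule AE_eq_0_of_test_functions[OF \<Omega>])
    show "integrable (lebesgue_on \<Omega>) (\<lambda>x. weak_laplacian \<Omega> y x - (q x - F x))"
      using int L2 q F by simp
    fix \<phi> assume \<phi>: "test_function \<Omega> \<phi>"
    have "integrable (lebesgue_on \<Omega>) (\<lambda>x. u x * \<phi> x)" if "u \<in> Lp \<Omega> 2" for u
      using int[OF that] \<phi> by (rule integrable_mult_test_function)
    moreover have "- (\<integral>x. weak_laplacian \<Omega> y x * \<phi> x \<partial>lebesgue_on \<Omega>) + L2_inner \<Omega> q \<phi> = L2_inner \<Omega> F \<phi>"
      using sol[unfolded weak_solution_def, rule_format, OF test_function_in_H10[OF \<Omega> \<phi>]]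
      by (simp only: weak_grad_inner_test_function[OF \<Omega> Y_space_H1[OF y] w \<phi>])
    ultimately show "(\<integral>x. (weak_laplacian \<Omega> y x - (q x - F x)) * \<phi> x \<partial>lebesgue_on \<Omega>) = 0"
      using L2 q F by (simp add: L2_inner_def left_diff_distrib)
  qed
  then show ?thesis by eventually_elim simp
qed

section \<open>Superposition operators\<close>

text \<open>Monotonicity takes the place of the continuity usual in a density argument: the
  increment over [y1, y2] is at most the increment over a slightly larger interval with rational
  ends.\<close>

lemma mono_lipschitz_if_lipschitz_on_Rats:
  fixes F :: "real \<Rightarrow> real"
  assumes F: "mono F" and L: "0 < L"
    and rat: "\<And>r s. r \<in> {-M<..<M} \<inter> \<rat> \<Longrightarrow> s \<in> {-M<..<M} \<inter> \<rat> \<Longrightarrow> \<bar>F r - F s\<bar> \<le> L * \<bar>r - s\<bar>"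
    and y: "y1 \<in> {-M<..<M}" "y2 \<in> {-M<..<M}"
  shows "\<bar>F y1 - F y2\<bar> \<le> L * \<bar>y1 - y2\<bar>"
proof -
  have *: "F y2 - F y1 \<le> L * (y2 - y1)" if "y1 \<le> y2" "y1 \<in> {-M<..<M}" "y2 \<in> {-M<..<M}" for y1 y2
  proof (rule field_le_epsilon)
    fix e :: real assume "0 < e"
    \<comment> \<open>Widening the interval by d at both ends costs at most 2 L d = e.\<close>
    define d where "d = e / (2 * L)"
    have d: "0 < d" "L * d = e / 2" using \<open>0 < e\<close> L by (auto simp: d_def)
    have "max (- M) (y1 - d) < y1" "y2 < min M (y2 + d)" using that d(1) by auto
    then obtain r s where r: "r \<in> \<rat>" "max (- M) (y1 - d) < r" "r < y1"
      and s: "s \<in> \<rat>" "y2 < s" "s < min M (y2 + d)"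
      using Rats_dense_in_real by meson
    have "F y2 - F y1 \<le> F s - F r"
      using monoD[OF F, of y2 s] monoD[OF F, of r y1] r s by simp
    also have "\<dots> \<le> L * \<bar>s - r\<bar>"
      using rat[of s r] r s that by auto
    also have "\<dots> \<le> L * ((y2 - y1) + 2 * d)"
      using r s that L by (intro mult_left_mono) auto
    also have "\<dots> = L * (y2 - y1) + e"
      using d(2) by (simp add: distrib_left)
    finally show "F y2 - F y1 \<le> L * (y2 - y1) + e" .
  qed
  show ?thesis
  proof (cases "y1 \<le> y2")
    case True
    with *[OF True y] monoD[OF F True] show ?thesis by simp
  next
    case False
    then have "y2 \<le> y1" by simp
    with *[OF this y(2,1)] monoD[OF F this] show ?thesis by simp
  qed
qed

text \<open>One null set serves the countably many rational pairs, and monotonicity extends the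
  estimate to all real pairs.\<close>

lemma A2_A3_uniform_null_set:
  assumes "A2 \<Omega> f" "A3 \<Omega> f" "0 < M"
  obtains L where "0 < L"
    "AE x in lebesgue_on \<Omega>. \<forall>r\<in>{-M<..<M}. \<forall>s\<in>{-M<..<M}. \<bar>f x r - f x s\<bar> \<le> L * \<bar>r - s\<bar>"
proof -
  obtain L where L: "0 < L"
    "\<And>r s. r \<in> {-M<..<M} \<Longrightarrow> s \<in> {-M<..<M} \<Longrightarrow> AE x in lebesgue_on \<Omega>. \<bar>f x r - f x s\<bar> \<le> L * \<bar>r - s\<bar>"
    using assms unfolding A2_def by meson
  have count: "countable ({-M<..<M} \<inter> \<rat>)"
    by (intro countable_Int2 countable_rat)
  have "AE x in lebesgue_on \<Omega>. \<forall>r\<in>{-M<..<M} \<inter> \<rat>. \<forall>s\<in>{-M<..<M} \<inter> \<rat>. \<bar>f x r - f x s\<bar> \<le> L * \<bar>r - s\<bar>"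
    unfolding AE_ball_countable[OF count] using L(2) by blast
  moreover have "AE x in lebesgue_on \<Omega>. mono (f x)" using assms by (simp add: A3_def)
  ultimately have "AE x in lebesgue_on \<Omega>. \<forall>r\<in>{-M<..<M}. \<forall>s\<in>{-M<..<M}. \<bar>f x r - f x s\<bar> \<le> L * \<bar>r - s\<bar>"
  proof eventually_elim
    case (elim x)
    show ?case
      by (intro ballI, rule mono_lipschitz_if_lipschitz_on_Rats[OF elim(2) L(1)])
        (rule elim(1)[rule_format])
  qed
  with L(1) that show thesis by blast
qed

text \<open>Meant for a single \<open>f x\<close>, so the constant may depend on x as well as on
  M.\<close>

definition locally_lipschitz :: "(real \<Rightarrow> real) \<Rightarrow> bool" where
  "locally_lipschitz F \<longleftrightarrow>
     (\<forall>M>0. \<exists>L>0. \<forall>r\<in>{-M<..<M}. \<forall>s\<in>{-M<..<M}. \<bar>F r - F s\<bar> \<le> L * \<bar>r - s\<bar>)"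

lemma AE_locally_lipschitz:
  assumes "A2 \<Omega> f" "A3 \<Omega> f"
  shows "AE x in lebesgue_on \<Omega>. locally_lipschitz (f x)"
proof -
  have "AE x in lebesgue_on \<Omega>. \<exists>L>0. \<forall>r\<in>{- real (Suc k)<..<real (Suc k)}. \<forall>s\<in>{- real (Suc k)<..<real (Suc k)}.
      \<bar>f x r - f x s\<bar> \<le> L * \<bar>r - s\<bar>" for k
  proof -
    obtain L where "0 < L" and L: "AE x in lebesgue_on \<Omega>. \<forall>r\<in>{- real (Suc k)<..<real (Suc k)}.
        \<forall>s\<in>{- real (Suc k)<..<real (Suc k)}. \<bar>f x r - f x s\<bar> \<le> L * \<bar>r - s\<bar>"
      using A2_A3_uniform_null_set[OF assms, of "real (Suc k)"] by auto
    from L show ?thesis by eventually_elim (use \<open>0 < L\<close> in blast)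
  qed
  then have "AE x in lebesgue_on \<Omega>. \<forall>k. \<exists>L>0. \<forall>r\<in>{- real (Suc k)<..<real (Suc k)}.
      \<forall>s\<in>{- real (Suc k)<..<real (Suc k)}. \<bar>f x r - f x s\<bar> \<le> L * \<bar>r - s\<bar>"
    by (simp add: AE_all_countable)
  then show ?thesis
  proof eventually_elim
    case (elim x)
    show ?case
      unfolding locally_lipschitz_def
    proof (intro allI impI)
      fix M :: real assume "0 < M"
      obtain k where "M \<le> real k" using real_arch_simple by blast
      then have "{-M<..<M} \<subseteq> {- real (Suc k)<..<real (Suc k)}" by auto
      with elim[rule_format, of k]
      show "\<exists>L>0. \<forall>r\<in>{-M<..<M}. \<forall>s\<in>{-M<..<M}. \<bar>f x r - f x s\<bar> \<le> L * \<bar>r - s\<bar>"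
        by (meson subsetD)
    qed
  qed
qed

lemma locally_lipschitz_isCont:
  assumes "locally_lipschitz F"
  shows "isCont F y"
proof -
  define M where "M = \<bar>y\<bar> + 1"
  have "0 < M" by (simp add: M_def)
  then obtain L where L: "\<And>r s. r \<in> {-M<..<M} \<Longrightarrow> s \<in> {-M<..<M} \<Longrightarrow> \<bar>F r - F s\<bar> \<le> L * \<bar>r - s\<bar>"
    using assms unfolding locally_lipschitz_def by meson
  have y: "y \<in> {-M<..<M}" by (auto simp: M_def)
  have "((\<lambda>r. F r - F y) \<longlongrightarrow> 0) (at y)"
  proof (rule Lim_null_comparison)
    have "\<forall>\<^sub>F r in at y. r \<in> {-M<..<M}"
      using y by (intro eventually_at_in_open') auto
    then show "\<forall>\<^sub>F r in at y. norm (F r - F y) \<le> L * \<bar>r - y\<bar>"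
      by eventually_elim (use L y in auto)
    have "((\<lambda>r. L * \<bar>r - y\<bar>) \<longlongrightarrow> L * \<bar>y - y\<bar>) (at y)"
      by (intro tendsto_intros)
    then show "((\<lambda>r. L * \<bar>r - y\<bar>) \<longlongrightarrow> 0) (at y)" by simp
  qed
  then show ?thesis by (simp add: isCont_def LIM_zero_iff)
qed

section \<open>Measurability and integrability of superpositions\<close>

lemma floor_approx_tendsto:
  fixes y :: real
  shows "(\<lambda>n. real_of_int \<lfloor>real (Suc n) * y\<rfloor> / real (Suc n)) \<longlonglongrightarrow> y"
proof -
  have "(\<lambda>n. real_of_int \<lfloor>real (Suc n) * y\<rfloor> / real (Suc n) - y) \<longlonglongrightarrow> 0"
  proof (rule Lim_null_comparison[OF always_eventually LIMSEQ_Suc[OF lim_1_over_n]], intro allI)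
    fix n
    have "real_of_int \<lfloor>real (Suc n) * y\<rfloor> / real (Suc n) - y
        = (real_of_int \<lfloor>real (Suc n) * y\<rfloor> - real (Suc n) * y) / real (Suc n)"
      by (simp add: diff_divide_distrib del: of_nat_Suc)
    moreover have "\<bar>real_of_int \<lfloor>real (Suc n) * y\<rfloor> - real (Suc n) * y\<bar> \<le> 1" by linarith
    ultimately show "norm (real_of_int \<lfloor>real (Suc n) * y\<rfloor> / real (Suc n) - y) \<le> 1 / real (Suc n)"
      by (simp only: real_norm_def abs_divide abs_of_nat divide_right_mono of_nat_0_le_iff)
  qed
  then show ?thesis by (simp add: LIM_zero_iff)
qed

text \<open>Rounding y down to multiples of 1/(n+1) leaves countably many values, for which
  measurability in x is enough; continuity in the second argument passes it to the limit. Setting f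
  to 0 on the exceptional set makes the convergence hold everywhere.\<close>

lemma caratheodory_measurable:
  fixes f :: "'a::euclidean_space \<Rightarrow> real \<Rightarrow> real"
  assumes \<Omega>: "\<Omega> \<in> sets lebesgue" and f: "\<And>r. (\<lambda>x. f x r) \<in> borel_measurable (lebesgue_on \<Omega>)"
    and cont: "AE x in lebesgue_on \<Omega>. \<forall>r. isCont (f x) r"
    and y[measurable]: "y \<in> borel_measurable (lebesgue_on \<Omega>)"
  shows "(\<lambda>x. f x (y x)) \<in> borel_measurable (lebesgue_on \<Omega>)"
proof -
  obtain N where N_cont: "{x \<in> space (lebesgue_on \<Omega>). \<not> (\<forall>r. isCont (f x) r)} \<subseteq> N"
    and N: "emeasure (lebesgue_on \<Omega>) N = 0" "N \<in> sets (lebesgue_on \<Omega>)"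
    by (rule AE_E[OF cont])
  define f' where "f' x r = (if x \<in> N then 0 else f x r)" for x r
  define a where "a n x = real_of_int \<lfloor>real (Suc n) * y x\<rfloor> / real (Suc n)" for n x
  note [measurable] = f N(2)
  have [measurable]: "(\<lambda>x. f' x r) \<in> borel_measurable (lebesgue_on \<Omega>)" for r
    unfolding f'_def by measurable
  have meas': "(\<lambda>x. f' x (y x)) \<in> borel_measurable (lebesgue_on \<Omega>)"
  proof (rule borel_measurable_LIMSEQ_real)
    fix x assume "x \<in> space (lebesgue_on \<Omega>)"
    show "(\<lambda>n. f' x (a n x)) \<longlonglongrightarrow> f' x (y x)"
    proof (cases "x \<in> N")
      case False
      with N_cont \<open>x \<in> space _\<close> have "isCont (f x) (y x)" by blast
      then show ?thesis
        using False floor_approx_tendsto[of "y x"]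
        by (auto simp: f'_def a_def intro: isCont_tendsto_compose)
    qed (simp add: f'_def)
  next
    fix n
    have g: "(\<lambda>x. \<lfloor>real (Suc n) * y x\<rfloor>) \<in> measurable (lebesgue_on \<Omega>) (count_space UNIV)"
      by measurable
    show "(\<lambda>x. f' x (a n x)) \<in> borel_measurable (lebesgue_on \<Omega>)"
      unfolding a_def
      by (rule measurable_compose_countable[OF _ g, of "\<lambda>i x. f' x (real_of_int i / real (Suc n))"])
        measurable
  qed
  have "AE x in lebesgue_on \<Omega>. x \<notin> N"
    using N by (intro AE_not_in) auto
  \<comment> \<open>To undo the modification on \<open>N\<close>, the functions are extended by 0 to
    the whole space, where completeness of Lebesgue measure permits changes on null sets.\<close>
  then have "AE x in lebesgue. x \<in> \<Omega> \<longrightarrow> x \<notin> N"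
    using \<Omega> by (simp add: AE_restrict_space_iff)
  then have "AE x in lebesgue. (if x \<in> \<Omega> then f' x (y x) else 0) = (if x \<in> \<Omega> then f x (y x) else 0)"
    by eventually_elim (auto simp: f'_def)
  with borel_measurable_if_I[OF meas' \<Omega>]
  have "(\<lambda>x. if x \<in> \<Omega> then f x (y x) else 0) \<in> borel_measurable lebesgue"
    by (rule borel_measurable_AE)
  then show ?thesis by (rule borel_measurable_if_D)
qed

text \<open>A continuous function on the compact closure is bounded, so comparison with
  \<open>f x 0\<close> bounds the superposition on the bounded domain.\<close>

lemma superposition_Lp2:
  assumes \<Omega>: "open \<Omega>" "bounded \<Omega>" and A: "A1 \<Omega> f" "A2 \<Omega> f" "A3 \<Omega> f"
    and y: "continuous_on (closure \<Omega>) y"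
  shows "(\<lambda>x. f x (y x)) \<in> Lp \<Omega> 2"
proof -
  have \<Omega>': "\<Omega> \<in> sets lebesgue" using \<Omega>(1) by (intro sets_completionI_sets) simp
  have "compact (y ` closure \<Omega>)"
    using \<Omega> y by (intro compact_continuous_image) (simp_all add: compact_closure)
  then have "bounded (y ` closure \<Omega>)" by (rule compact_imp_bounded)
  then obtain K where K: "\<And>x. x \<in> \<Omega> \<Longrightarrow> \<bar>y x\<bar> \<le> K"
    using closure_subset[of \<Omega>] unfolding bounded_iff real_norm_def by blast
  \<comment> \<open>The added 1 places all values strictly inside the open interval; the maximum
    keeps M positive even if \<Omega> is empty and K arbitrary.\<close>
  define M where "M = max K 0 + 1"
  have "0 < M" by (simp add: M_def)
  obtain L where L: "0 < L"
    "AE x in lebesgue_on \<Omega>. \<forall>r\<in>{-M<..<M}. \<forall>s\<in>{-M<..<M}. \<bar>f x r - f x s\<bar> \<le> L * \<bar>r - s\<bar>"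
    using A2_A3_uniform_null_set[OF A(2,3) \<open>0 < M\<close>] .
  obtain B where B: "AE x in lebesgue_on \<Omega>. \<bar>f x 0\<bar> \<le> B"
    using A(1) by (auto simp: A1_def Linf_def)
  have "AE x in lebesgue_on \<Omega>. x \<in> \<Omega>" by (rule AE_I2) simp
  with B L(2) have bound: "AE x in lebesgue_on \<Omega>. norm (f x (y x)) \<le> B + L * M"
  proof eventually_elim
    case (elim x)
    have yx: "\<bar>y x\<bar> < M" using K[OF elim(3)] by (simp add: M_def)
    then have "\<bar>f x (y x) - f x 0\<bar> \<le> L * \<bar>y x - 0\<bar>"
      using \<open>0 < M\<close> by (intro elim(2)[rule_format]) auto
    also have "\<dots> \<le> L * M" using yx L(1) by simp
    finally show ?case using elim(1) by simp
  qed
  have f_meas: "(\<lambda>x. f x r) \<in> borel_measurable (lebesgue_on \<Omega>)" for r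
    using A(1) by (simp add: A1_def)
  have y_meas: "y \<in> borel_measurable (lebesgue_on \<Omega>)"
    by (rule continuous_imp_measurable_on_sets_lebesgue[OF continuous_on_subset[OF y closure_subset] \<Omega>'])
  have "AE x in lebesgue_on \<Omega>. \<forall>r. isCont (f x) r"
    using AE_locally_lipschitz[OF A(2,3)] by eventually_elim (simp add: locally_lipschitz_isCont)
  from caratheodory_measurable[OF \<Omega>' f_meas this y_meas]
  have "(\<lambda>x. f x (y x)) \<in> borel_measurable (lebesgue_on \<Omega>)" .
  from bounded_in_Lp[OF \<Omega> this bound] show ?thesis by simp
qed

section \<open>Directional derivatives of the nonlinearity\<close>

lemma has_dir_deriv_dir_deriv:
  "has_dir_deriv F y h D \<Longrightarrow> dir_deriv F y h = D"
  unfolding has_dir_deriv_def dir_deriv_def by (intro tendsto_Lim) auto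

lemma has_dir_deriv_scale:
  assumes "has_dir_deriv F y h D" "0 < c"
  shows "has_dir_deriv F y (c * h) (c * D)"
proof -
  have "filterlim (\<lambda>t. t * c) (at_right 0) (at_right 0)"
  proof -
    have "((\<lambda>t. t * c) \<longlongrightarrow> 0 * c) (at_right 0)" by (intro tendsto_intros)
    moreover have "\<forall>\<^sub>F t in at_right 0. t * c \<in> {0<..} \<and> t * c \<noteq> 0"
      using eventually_at_right_less[of 0] by eventually_elim (use \<open>0 < c\<close> in auto)
    ultimately show ?thesis by (simp add: filterlim_at)
  qed
  from filterlim_compose[OF assms(1)[unfolded has_dir_deriv_def] this]
  have "((\<lambda>t. c * ((F (y + t * c * h) - F y) / (t * c))) \<longlongrightarrow> c * D) (at_right 0)"
    by (rule tendsto_mult_left)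
  then show ?thesis
    using assms(2) by (simp add: has_dir_deriv_def mult.assoc)
qed

text \<open>Positive homogeneity from the directions 1 and -1. For \<eta> < 0 the scaling factor is
  -\<eta> and \<open>left_deriv\<close> carries a minus sign, so the two signs cancel.\<close>

lemma has_dir_deriv_one_sided:
  assumes "\<And>h. \<exists>D. has_dir_deriv F y h D"
  shows "has_dir_deriv F y \<eta> (\<eta> * (if 0 \<le> \<eta> then right_deriv F y else left_deriv F y))"
proof -
  have D: "has_dir_deriv F y h (dir_deriv F y h)" for h
    using assms has_dir_deriv_dir_deriv by blast
  consider "\<eta> = 0" | "0 < \<eta>" | "\<eta> < 0" by linarith
  then show ?thesis
  proof cases
    case 1
    then show ?thesis by (simp add: has_dir_deriv_def)
  next
    case 2
    then show ?thesis using has_dir_deriv_scale[OF D[of 1], of \<eta>] by (simp add: right_deriv_def)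
  next
    case 3
    then show ?thesis using has_dir_deriv_scale[OF D[of "- 1"], of "- \<eta>"] by (simp add: left_deriv_def)
  qed
qed

text \<open>For locally Lipschitz functions directional derivatives are Hadamard derivatives.\<close>

lemma has_dir_deriv_tendsto_sequence:
  assumes F: "locally_lipschitz F" and D: "has_dir_deriv F y \<eta> D"
    and t: "\<And>n. 0 < t n" "t \<longlonglongrightarrow> 0" and e: "e \<longlonglongrightarrow> \<eta>"
  shows "(\<lambda>n. (F (y + t n * e n) - F y) / t n) \<longlonglongrightarrow> D"
proof -
  have "filterlim t (at_right 0) sequentially"
    using t by (auto simp: filterlim_at less_imp_neq[symmetric])
  from filterlim_compose[OF D[unfolded has_dir_deriv_def] this]
  have lim: "(\<lambda>n. (F (y + t n * \<eta>) - F y) / t n) \<longlonglongrightarrow> D" .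
  define M where "M = \<bar>y\<bar> + 1"
  have "0 < M" by (simp add: M_def)
  then obtain L where L: "\<And>r s. r \<in> {-M<..<M} \<Longrightarrow> s \<in> {-M<..<M} \<Longrightarrow> \<bar>F r - F s\<bar> \<le> L * \<bar>r - s\<bar>"
    using F unfolding locally_lipschitz_def by meson
  have near: "\<forall>\<^sub>F n in sequentially. y + t n * v n \<in> {-M<..<M}" if "v \<longlonglongrightarrow> w" for v w
  proof -
    have "(\<lambda>n. y + t n * v n) \<longlonglongrightarrow> y + 0 * w" by (intro tendsto_intros t that)
    then show ?thesis by (rule topological_tendstoD) (auto simp: M_def)
  qed
  have "(\<lambda>n. (F (y + t n * e n) - F y) / t n - (F (y + t n * \<eta>) - F y) / t n) \<longlonglongrightarrow> 0"
  proof (rule Lim_null_comparison)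
    show "\<forall>\<^sub>F n in sequentially. norm ((F (y + t n * e n) - F y) / t n - (F (y + t n * \<eta>) - F y) / t n)
        \<le> L * \<bar>e n - \<eta>\<bar>"
      using near[OF e] near[OF tendsto_const[of \<eta>]]
    proof eventually_elim
      case (elim n)
      have "\<bar>F (y + t n * e n) - F (y + t n * \<eta>)\<bar> \<le> L * \<bar>t n * (e n - \<eta>)\<bar>"
        using L[OF elim] by (simp add: right_diff_distrib)
      also have "\<dots> = t n * (L * \<bar>e n - \<eta>\<bar>)"
        using t(1)[of n] by (simp add: abs_mult)
      finally have "\<bar>F (y + t n * e n) - F (y + t n * \<eta>)\<bar> / t n \<le> L * \<bar>e n - \<eta>\<bar>"
        using t(1)[of n] by (simp add: divide_le_eq mult.commute)
      moreover have "(F (y + t n * e n) - F y) / t n - (F (y + t n * \<eta>) - F y) / t n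
          = (F (y + t n * e n) - F (y + t n * \<eta>)) / t n"
        by (simp add: diff_divide_distrib)
      ultimately show ?case using t(1)[of n] by simp
    qed
    have "(\<lambda>n. L * \<bar>e n - \<eta>\<bar>) \<longlonglongrightarrow> L * \<bar>\<eta> - \<eta>\<bar>" by (intro tendsto_intros e)
    then show "(\<lambda>n. L * \<bar>e n - \<eta>\<bar>) \<longlonglongrightarrow> 0" by simp
  qed
  from tendsto_add[OF this lim] show ?thesis by simp
qed

lemma Linf_mult_Lp2:
  assumes "\<zeta> \<in> Linf \<Omega>" "v \<in> Lp \<Omega> 2"
  shows "(\<lambda>x. \<zeta> x * v x) \<in> Lp \<Omega> 2"
proof -
  obtain B where B: "AE x in lebesgue_on \<Omega>. \<bar>\<zeta> x\<bar> \<le> B" using assms by (auto simp: Linf_def)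
  have [measurable]: "\<zeta> \<in> borel_measurable (lebesgue_on \<Omega>)" "v \<in> borel_measurable (lebesgue_on \<Omega>)"
    using assms by (auto simp: Linf_def Lp_def)
  have "integrable (lebesgue_on \<Omega>) (\<lambda>x. (norm (\<zeta> x * v x))\<^sup>2)"
  proof (rule Bochner_Integration.integrable_bound)
    show "integrable (lebesgue_on \<Omega>) (\<lambda>x. B\<^sup>2 * (norm (v x))\<^sup>2)"
      using assms by (simp add: Lp2_iff)
    show "AE x in lebesgue_on \<Omega>. norm ((norm (\<zeta> x * v x))\<^sup>2) \<le> norm (B\<^sup>2 * (norm (v x))\<^sup>2)"
      using B
    proof eventually_elim
      case (elim x)
      then have "(\<zeta> x)\<^sup>2 \<le> B\<^sup>2" by (metis abs_ge_zero power2_abs power_mono)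
      then show ?case by (simp add: power_mult_distrib mult_right_mono)
    qed
  qed measurable
  then show ?thesis by (simp add: Lp2_iff)
qed

text \<open>The integrand of the squared Y norm is a sum of squares tending to 0 in L1. A
  subsequence along which it tends to 0 almost everywhere serves the functions and their Laplacians
  at once.\<close>

lemma Y_norm_tendsto_0_AE_subseq:
  assumes \<Omega>: "open \<Omega>" "bounded \<Omega>" and e: "\<And>n. e n \<in> H1 \<Omega>" "\<And>n. is_weak_laplacian \<Omega> (e n) (w n)"
    and lim: "(\<lambda>n. Y_norm \<Omega> (e n)) \<longlonglongrightarrow> 0"
  obtains r :: "nat \<Rightarrow> nat" where "strict_mono r"
    "AE x in lebesgue_on \<Omega>. (\<lambda>n. e (r n) x) \<longlonglongrightarrow> 0 \<and> (\<lambda>n. weak_laplacian \<Omega> (e (r n)) x) \<longlonglongrightarrow> 0"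
proof -
  define I where "I n x = weak_laplacian \<Omega> (e n) x * weak_laplacian \<Omega> (e n) x
    + weak_grad \<Omega> (e n) x \<bullet> weak_grad \<Omega> (e n) x + e n x * e n x" for n x
  have lap: "weak_laplacian \<Omega> (e n) \<in> Lp \<Omega> 2" for n
    using weak_laplacian_spec[OF e(2)] by (simp add: is_weak_laplacian_def)
  have int: "integrable (lebesgue_on \<Omega>) (I n)" for n
    unfolding I_def
    by (intro Bochner_Integration.integrable_add Lp2_mult_integrable Lp2_inner_integrable
        lap weak_grad_Lp2 H1_Lp2 e)
  have nonneg: "0 \<le> I n x" for n x by (simp add: I_def)
  have "(\<integral>x. norm (I n x) \<partial>lebesgue_on \<Omega>) = (Y_norm \<Omega> (e n))\<^sup>2" for n
  proof -
    have "Y_inner \<Omega> (e n) (e n) = (\<integral>x. I n x \<partial>lebesgue_on \<Omega>)"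
      by (simp add: Y_inner_def I_def)
    moreover have "0 \<le> (\<integral>x. I n x \<partial>lebesgue_on \<Omega>)"
      by (intro Bochner_Integration.integral_nonneg nonneg)
    ultimately show ?thesis by (simp add: Y_norm_def nonneg)
  qed
  moreover have "(\<lambda>n. (Y_norm \<Omega> (e n))\<^sup>2) \<longlonglongrightarrow> 0\<^sup>2" by (intro tendsto_power lim)
  ultimately have "(\<lambda>n. \<integral>x. norm (I n x) \<partial>lebesgue_on \<Omega>) \<longlonglongrightarrow> 0" by simp
  from tendsto_L1_AE_subseq[OF int this] obtain r :: "nat \<Rightarrow> nat"
    where r: "strict_mono r" "AE x in lebesgue_on \<Omega>. (\<lambda>n. I (r n) x) \<longlonglongrightarrow> 0" by blast
  have sq: "c \<longlonglongrightarrow> 0" if "I' \<longlonglongrightarrow> 0" "\<And>n. (c n)\<^sup>2 \<le> I' n" for c I' :: "nat \<Rightarrow> real"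
  proof -
    have "(\<lambda>n. (c n)\<^sup>2) \<longlonglongrightarrow> 0"
      by (rule Lim_null_comparison[OF always_eventually that(1)]) (simp add: that(2))
    then show ?thesis by (simp add: tendsto_null_power)
  qed
  have "AE x in lebesgue_on \<Omega>. (\<lambda>n. e (r n) x) \<longlonglongrightarrow> 0 \<and> (\<lambda>n. weak_laplacian \<Omega> (e (r n)) x) \<longlonglongrightarrow> 0"
    using r(2)
  proof eventually_elim
    case (elim x)
    have "(e n x)\<^sup>2 \<le> I n x" "(weak_laplacian \<Omega> (e n) x)\<^sup>2 \<le> I n x" for n
      by (auto simp: I_def power2_eq_square)
    from sq[OF elim this(1)] sq[OF elim this(2)] show ?case by blast
  qed
  with r(1) that show thesis by blast
qed

section \<open>Stationarity\<close>

text \<open>Inserting u = \<open>ubar\<close> + \<open>t n\<close> \<open>hn n\<close> and dividing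
  by \<open>t n\<close> > 0 gives the inequality for \<open>hn n\<close>. Since w is only square
  integrable, the limit is taken in L2, which p \<ge> 2 on a bounded domain allows.\<close>

lemma contingent_cone_variational_inequality:
  assumes \<Omega>: "open \<Omega>" "bounded \<Omega>" and p: "2 \<le> p" and w: "w \<in> Lp \<Omega> 2"
    and h: "h \<in> contingent_cone \<Omega> p C ubar"
    and var: "\<And>u. u \<in> C \<Longrightarrow> 0 \<le> L2_inner \<Omega> w (\<lambda>x. u x - ubar x)"
  shows "0 \<le> L2_inner \<Omega> w h"
proof -
  obtain t :: "nat \<Rightarrow> real" and hn where h_Lp: "h \<in> Lp \<Omega> p" and t: "\<And>n. 0 < t n"
    and hn: "\<And>n. hn n \<in> Lp \<Omega> p" and lim: "(\<lambda>n. Lp_norm \<Omega> p (\<lambda>x. hn n x - h x)) \<longlonglongrightarrow> 0"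
    and C: "\<And>n. (\<lambda>x. ubar x + t n * hn n x) \<in> C"
    using h by (auto simp: contingent_cone_def)
  have "(\<lambda>n. Lp_norm \<Omega> 2 (\<lambda>x. hn n x - h x)) \<longlonglongrightarrow> 0"
    using lim p by (intro Lp_tendsto_imp_Lp2_tendsto[OF \<Omega> p] Lp_diff hn h_Lp) auto
  then have "(\<lambda>n. \<integral>x. w x \<bullet> hn n x \<partial>lebesgue_on \<Omega>) \<longlonglongrightarrow> (\<integral>x. w x \<bullet> h x \<partial>lebesgue_on \<Omega>)"
    using Lp_subset_Lp2[OF \<Omega> p] hn h_Lp by (intro Lp2_inner_tendsto w) auto
  moreover have "0 \<le> (\<integral>x. w x \<bullet> hn n x \<partial>lebesgue_on \<Omega>)" for n
  proof -
    have "0 \<le> (\<integral>x. t n * (w x * hn n x) \<partial>lebesgue_on \<Omega>)"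
      using var[OF C[of n]] by (simp add: L2_inner_def mult.left_commute)
    then show ?thesis using t[of n] by (simp add: zero_le_mult_iff)
  qed
  ultimately have "0 \<le> (\<integral>x. w x \<bullet> h x \<partial>lebesgue_on \<Omega>)"
    by (intro LIMSEQ_le_const) auto
  then show ?thesis by (simp add: L2_inner_def)
qed

lemma linearized_state_equation_AE:
  assumes \<Omega>: "open \<Omega>" "bounded \<Omega>" and p: "2 \<le> p"
    and A: "A1 \<Omega> f" "A2 \<Omega> f" "A3 \<Omega> f" "A4 \<Omega> f"
    and S: "control_to_state_map \<Omega> f p a S" and S': "directional_derivative_map \<Omega> p S S'"
    and u: "u \<in> Lp \<Omega> p" and h: "h \<in> Lp \<Omega> p"
  shows "AE x in lebesgue_on \<Omega>. weak_laplacian \<Omega> (S' u h) x + h x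
    = S' u h x * (if 0 \<le> S' u h x then right_deriv (f x) (S u x) else left_deriv (f x) (S u x))"
proof -
  \<comment> \<open>A single null sequence is enough: the limit in Y exists by assumption and only
    has to be identified.\<close>
  define t where "t n = 1 / real (Suc n)" for n
  have t: "0 < t n" for n by (simp add: t_def)
  have t0: "t \<longlonglongrightarrow> 0" unfolding t_def by (rule LIMSEQ_Suc[OF lim_1_over_n])
  define U where "U n = (\<lambda>x. u x + t n * h x)" for n
  have U: "U n \<in> Lp \<Omega> p" for n
    unfolding U_def using u h p by (intro Lp_add Lp_mult) auto
  have state: "S v \<in> Y_space \<Omega>" "(\<lambda>x. f x (S v x)) \<in> Lp \<Omega> 2"
    "AE x in lebesgue_on \<Omega>. weak_laplacian \<Omega> (S v) x = f x (S v x) - v x" if v: "v \<in> Lp \<Omega> p" for v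
  proof -
    have "is_state \<Omega> f a v (S v)" using S v by (simp add: control_to_state_map_def)
    then have *: "S v \<in> Y_space \<Omega>" "continuous_on (closure \<Omega>) (S v)"
      "weak_solution \<Omega> (S v) (\<lambda>x. f x (S v x)) v"
      by (auto simp: is_state_def holder_space_def)
    show "S v \<in> Y_space \<Omega>" by fact
    show q: "(\<lambda>x. f x (S v x)) \<in> Lp \<Omega> 2" by (rule superposition_Lp2[OF \<Omega> A(1-3) *(2)])
    show "AE x in lebesgue_on \<Omega>. weak_laplacian \<Omega> (S v) x = f x (S v x) - v x"
      by (rule weak_solution_laplacian_AE[OF \<Omega> *(1) q Lp_subset_Lp2[OF \<Omega> p v] *(3)])
  qed
  let ?y = "S u" and ?\<eta> = "S' u h"
  have \<eta>: "?\<eta> \<in> Y_space \<Omega>" using S' u h by (simp add: directional_derivative_map_def)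
  define e where "e n = (\<lambda>x. (S (U n) x - ?y x) / t n - ?\<eta> x)" for n
  have lim: "(\<lambda>n. Y_norm \<Omega> (e n)) \<longlonglongrightarrow> 0"
  proof -
    have "((\<lambda>t. Y_norm \<Omega> (\<lambda>x. (S (\<lambda>z. u z + t * h z) x - S u x) / t - S' u h x)) \<longlongrightarrow> 0) (at_right 0)"
      using S' u h by (simp add: directional_derivative_map_def)
    moreover have "filterlim t (at_right 0) sequentially"
      using t t0 by (auto simp: filterlim_at less_imp_neq[symmetric])
    ultimately show ?thesis
      unfolding e_def U_def by (rule filterlim_compose)
  qed
  \<comment> \<open>The difference quotient written as a multiple of a difference, to which
    linearity of weak gradients and Laplacians applies.\<close>
  define E where "E n x = (1 / t n) * (S (U n) x - ?y x)" for n x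
  have e_eq: "e n = (\<lambda>x. E n x - ?\<eta> x)" for n by (simp add: e_def E_def)
  note YH = Y_space_H1[OF state(1)] and YL = Y_space_weak_laplacian[OF state(1)]
  have E: "E n \<in> H1 \<Omega>" for n
  proof -
    note d = weak_grad_diff_AE(2)[OF \<Omega> YH[OF U[of n]] YH[OF u]]
    from is_weak_grad_cmult[OF weak_grad_spec[OF d]] Lp_mult[OF H1_Lp2[OF d]] show ?thesis
      unfolding H1_def E_def by blast
  qed
  have e_H1: "e n \<in> H1 \<Omega>" for n
    unfolding e_eq by (rule weak_grad_diff_AE(2)[OF \<Omega> E Y_space_H1[OF \<eta>]])
  have "is_weak_laplacian \<Omega> (E n)
      (\<lambda>x. (1 / t n) * (weak_laplacian \<Omega> (S (U n)) x - weak_laplacian \<Omega> ?y x))" for n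
    unfolding E_def
    by (intro is_weak_laplacian_cmult is_weak_laplacian_diff \<Omega> H1_Lp2 YH YL U u)
  from is_weak_laplacian_diff[OF \<Omega> H1_Lp2[OF E] H1_Lp2[OF Y_space_H1[OF \<eta>]] this
      Y_space_weak_laplacian[OF \<eta>]]
  have e_lap: "is_weak_laplacian \<Omega> (e n)
      (\<lambda>x. (1 / t n) * (weak_laplacian \<Omega> (S (U n)) x - weak_laplacian \<Omega> ?y x) - weak_laplacian \<Omega> ?\<eta> x)" for n
    unfolding e_eq .
  \<comment> \<open>Subtract the two state equations and divide by \<open>t n\<close>; the controls
    contribute exactly h.\<close>
  have "AE x in lebesgue_on \<Omega>. weak_laplacian \<Omega> (e n) x
      = (f x (S (U n) x) - f x (?y x)) / t n - h x - weak_laplacian \<Omega> ?\<eta> x" for n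
    using is_weak_laplacian_AE_unique[OF \<Omega> weak_laplacian_spec[OF e_lap] e_lap, of n]
      state(3)[OF U, of n] state(3)[OF u]
  proof eventually_elim
    case (elim x)
    then show ?case using t[of n] by (simp add: U_def field_simps)
  qed
  then have lap_eq: "AE x in lebesgue_on \<Omega>. \<forall>n. weak_laplacian \<Omega> (e n) x
      = (f x (S (U n) x) - f x (?y x)) / t n - h x - weak_laplacian \<Omega> ?\<eta> x"
    by (simp add: AE_all_countable)
  obtain r :: "nat \<Rightarrow> nat" where r: "strict_mono r"
    "AE x in lebesgue_on \<Omega>. (\<lambda>n. e (r n) x) \<longlonglongrightarrow> 0 \<and> (\<lambda>n. weak_laplacian \<Omega> (e (r n)) x) \<longlonglongrightarrow> 0"
    using Y_norm_tendsto_0_AE_subseq[OF \<Omega> e_H1 e_lap lim] by blast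
  have "AE x in lebesgue_on \<Omega>. \<forall>y h. \<exists>D. has_dir_deriv (f x) y h D"
    using A(4) by (simp add: A4_def)
  with lap_eq r(2) AE_locally_lipschitz[OF A(2,3)] show ?thesis
  proof eventually_elim
    case (elim x)
    let ?D = "?\<eta> x * (if 0 \<le> ?\<eta> x then right_deriv (f x) (?y x) else left_deriv (f x) (?y x))"
    have D: "has_dir_deriv (f x) (?y x) (?\<eta> x) ?D"
      using elim(4) by (intro has_dir_deriv_one_sided) blast
    have "(\<lambda>n. e (r n) x + ?\<eta> x) \<longlonglongrightarrow> 0 + ?\<eta> x"
      using elim(2) by (intro tendsto_intros) auto
    then have \<eta>_lim: "(\<lambda>n. E (r n) x) \<longlonglongrightarrow> ?\<eta> x" by (simp add: e_eq)
    \<comment> \<open>The perturbed state is \<open>?y x + t n * E n x\<close> with directions that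
      vary with n, so the Hadamard form of the derivative is required.\<close>
    have "(\<lambda>n. (f x (?y x + t (r n) * E (r n) x) - f x (?y x)) / t (r n)) \<longlonglongrightarrow> ?D"
      using LIMSEQ_subseq_LIMSEQ[OF t0 r(1)] t
      by (intro has_dir_deriv_tendsto_sequence[OF elim(3) D _ _ \<eta>_lim]) (auto simp: o_def)
    moreover have "?y x + t n * E n x = S (U n) x" for n
      using t[of n] by (simp add: E_def)
    ultimately have "(\<lambda>n. (f x (S (U (r n)) x) - f x (?y x)) / t (r n)) \<longlonglongrightarrow> ?D" by simp
    then have "(\<lambda>n. weak_laplacian \<Omega> (e (r n)) x) \<longlonglongrightarrow> ?D - h x - weak_laplacian \<Omega> ?\<eta> x"
      using elim(1) by (simp add: tendsto_diff)
    \<comment> \<open>Along the subsequence the Laplacians of the errors have this limit and the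
      limit 0; equating the two gives the linearized equation at x.\<close>
    with elim(2) have "?D - h x - weak_laplacian \<Omega> ?\<eta> x = 0"
      using LIMSEQ_unique by blast
    then show ?case by linarith
  qed
qed

theorem proposition5p7:
  fixes \<Omega> :: "'a::euclidean_space set"
    and f :: "'a \<Rightarrow> real \<Rightarrow> real"
    and p a \<alpha> :: real
    and S :: "('a \<Rightarrow> real) \<Rightarrow> ('a \<Rightarrow> real)"
    and S' :: "('a \<Rightarrow> real) \<Rightarrow> ('a \<Rightarrow> real) \<Rightarrow> ('a \<Rightarrow> real)"
    and C_ad :: "('a \<Rightarrow> real) set"
    and g ubar :: "'a \<Rightarrow> real"
  assumes "DIM('a) \<ge> 2"
    and "lipschitz_domain \<Omega>"
    and "A1 \<Omega> f" and "A2 \<Omega> f" and "A3 \<Omega> f" and "A4 \<Omega> f"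
    and "p \<ge> 2" and "p > real DIM('a) / 2"
    and "a > 0"
    and "control_to_state_map \<Omega> f p a S"
    and "directional_derivative_map \<Omega> p S S'"
    and "C_ad \<subseteq> Lp \<Omega> p" and "C_ad \<noteq> {}"
    and "Lp_bounded \<Omega> p C_ad" and "Lp_closed \<Omega> p C_ad" and "fun_convex C_ad"
    and "g \<in> Lp \<Omega> 2"
    and "\<alpha> > 0"
    and "ubar \<in> C_ad"
    and "strongly_stationary \<Omega> f S C_ad g \<alpha> ubar"
  shows "B_stationary \<Omega> p S S' C_ad g \<alpha> ubar"
  unfolding B_stationary_def
proof
  fix h assume h: "h \<in> contingent_cone \<Omega> p C_ad ubar"
  have \<Omega>: "open \<Omega>" "bounded \<Omega>" using \<open>lipschitz_domain \<Omega>\<close> by (auto simp: lipschitz_domain_def)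
  note p = \<open>p \<ge> 2\<close>
  have u: "ubar \<in> Lp \<Omega> p" using \<open>ubar \<in> C_ad\<close> \<open>C_ad \<subseteq> Lp \<Omega> p\<close> by blast
  have h_Lp: "h \<in> Lp \<Omega> p" using h by (simp add: contingent_cone_def)
  note u2 = Lp_subset_Lp2[OF \<Omega> p u] and h2 = Lp_subset_Lp2[OF \<Omega> p h_Lp]
  obtain \<zeta> \<phi> where \<zeta>: "\<zeta> \<in> Linf \<Omega>" and \<phi>: "\<phi> \<in> Y_space \<Omega>"
    and adjoint: "weak_solution \<Omega> \<phi> (\<lambda>x. \<zeta> x * \<phi> x) (\<lambda>x. S ubar x - g x)"
    and var: "\<And>u. u \<in> C_ad \<Longrightarrow> 0 \<le> L2_inner \<Omega> (\<lambda>x. \<phi> x + \<alpha> * ubar x) (\<lambda>x. u x - ubar x)"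
    and sign: "AE x in lebesgue_on \<Omega>. right_deriv (f x) (S ubar x) * \<phi> x \<le> \<zeta> x * \<phi> x \<and>
        \<zeta> x * \<phi> x \<le> left_deriv (f x) (S ubar x) * \<phi> x"
    using \<open>strongly_stationary \<Omega> f S C_ad g \<alpha> ubar\<close>
    unfolding strongly_stationary_def C_stationary_with_def by blast
  let ?\<eta> = "S' ubar h"
  let ?w = "weak_laplacian \<Omega> ?\<eta>"
  have \<eta>: "?\<eta> \<in> Y_space \<Omega>"
    using \<open>directional_derivative_map \<Omega> p S S'\<close> u h_Lp by (simp add: directional_derivative_map_def)
  then have \<eta>_H10: "?\<eta> \<in> H10 \<Omega>" and \<phi>_H10: "\<phi> \<in> H10 \<Omega>" using \<phi> by (auto simp: Y_space_def)
  have \<eta>2: "?\<eta> \<in> Lp \<Omega> 2" and \<phi>2: "\<phi> \<in> Lp \<Omega> 2"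
    using \<eta> \<phi> by (auto intro: H1_Lp2 Y_space_H1)
  have w2: "?w \<in> Lp \<Omega> 2"
    using Y_space_weak_laplacian[OF \<eta>] by (simp add: is_weak_laplacian_def)
  note \<zeta>\<phi>2 = Linf_mult_Lp2[OF \<zeta> \<phi>2]

  have "(\<integral>x. (?w x + h x) * \<phi> x \<partial>lebesgue_on \<Omega>) \<le> (\<integral>x. \<zeta> x * \<phi> x * ?\<eta> x \<partial>lebesgue_on \<Omega>)"
  proof (rule integral_mono_AE)
    show "integrable (lebesgue_on \<Omega>) (\<lambda>x. (?w x + h x) * \<phi> x)"
      by (intro Lp2_mult_integrable Lp_add w2 h2 \<phi>2) simp
    show "integrable (lebesgue_on \<Omega>) (\<lambda>x. \<zeta> x * \<phi> x * ?\<eta> x)"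
      by (intro Lp2_mult_integrable \<zeta>\<phi>2 \<eta>2)
    show "AE x in lebesgue_on \<Omega>. (?w x + h x) * \<phi> x \<le> \<zeta> x * \<phi> x * ?\<eta> x"
      using sign linearized_state_equation_AE[OF \<Omega> p assms(3-6) assms(10,11) u h_Lp]
    proof eventually_elim
      case (elim x)
      show ?case
      \<comment> \<open>For nonnegative \<eta> the linearization carries the right derivative, and
        the lower bound in the sign condition is multiplied by \<eta>. For negative \<eta> it
        carries the left derivative, and multiplication reverses the upper bound. Both cases end in
        the same inequality.\<close>
      proof (cases "0 \<le> ?\<eta> x")
        case True
        then have "right_deriv (f x) (S ubar x) * \<phi> x * ?\<eta> x \<le> \<zeta> x * \<phi> x * ?\<eta> x"
          by (rule mult_right_mono[OF elim(1)[THEN conjunct1]])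
        with True show ?thesis by (simp add: elim(2) mult_ac)
      next
        case False
        then have "left_deriv (f x) (S ubar x) * \<phi> x * ?\<eta> x \<le> \<zeta> x * \<phi> x * ?\<eta> x"
          using elim(1) by (intro mult_right_mono_neg[OF elim(1)[THEN conjunct2]]) simp
        with False show ?thesis by (simp add: elim(2) mult_ac)
      qed
    qed
  qed
  moreover have "(\<integral>x. (?w x + h x) * \<phi> x \<partial>lebesgue_on \<Omega>)
      = (\<integral>x. ?w x * \<phi> x \<partial>lebesgue_on \<Omega>) + L2_inner \<Omega> \<phi> h"
    using Lp2_mult_integrable[OF w2 \<phi>2] Lp2_mult_integrable[OF h2 \<phi>2]
    by (simp add: L2_inner_def distrib_left mult.commute)
  \<comment> \<open>The adjoint equation is tested with \<eta>, while Green's formula is applied to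
    \<eta> with \<phi> as the test element. Thus the Laplacian of \<eta> appears and cancels against
    the preceding identity.\<close>
  moreover have "L2_inner \<Omega> (\<lambda>x. S ubar x - g x) ?\<eta>
      = - (\<integral>x. ?w x * \<phi> x \<partial>lebesgue_on \<Omega>) + (\<integral>x. \<zeta> x * \<phi> x * ?\<eta> x \<partial>lebesgue_on \<Omega>)"
    using adjoint[unfolded weak_solution_def, rule_format, OF \<eta>_H10]
      weak_grad_inner_H10[OF \<Omega> Y_space_H1[OF \<eta>] Y_space_weak_laplacian[OF \<eta>] \<phi>_H10]
    by (simp add: inner_commute L2_inner_def)
  moreover have "0 \<le> L2_inner \<Omega> \<phi> h + \<alpha> * L2_inner \<Omega> ubar h"
  proof -
    have "0 \<le> L2_inner \<Omega> (\<lambda>x. \<phi> x + \<alpha> * ubar x) h"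
      by (rule contingent_cone_variational_inequality[OF \<Omega> p _ h var])
        (intro Lp_add Lp_mult \<phi>2 u2; simp)
    then show ?thesis
      using Lp2_mult_integrable[OF \<phi>2 h2] Lp2_mult_integrable[OF u2 h2]
      by (simp add: L2_inner_def distrib_right mult.assoc)
  qed
  ultimately show "0 \<le> L2_inner \<Omega> (\<lambda>x. S ubar x - g x) ?\<eta> + \<alpha> * L2_inner \<Omega> ubar h"
    by linarith
qed

end
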